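(* Let $I$ be a nonempty set (finite or infinite), let $G$ be a discrete group, and let $S=B(I,G)$ be the Brandt semigroup over $G$ with index set $I$. Suppose that $G$ is amenable. Then the Banach semigroup algebra $\ell^1(S)$ is pseudo-amenable.
   Context: Brandt semigroup: let $T:=I\times G\times I$ and $S:=T\cup\{o\}$, where $o$ is an added null element not in $T$. The multiplication on $S$ is given by $(i,g,j)(i',g',j')=(i,gg',j')$ if $j=i'$ and $(i,g,j)(i',g',j')=o$ if $j\neq i'$, for $i,i',j,j'\in I$ and $g,g'\in G$, together with $o(i,g,j)=(i,g,j)o=o$ and $oo=o$. Then $S$ is a semigroup, called the Brandt semigroup over $G$ with index set $I$ and denoted $B(I,G)$. Semigroup algebra: $\ell^1(S)$ is the complex Banach space of absolutely summable functions on $S$ with the convolution product, i.e. the product determined by $\delta_s\delta_t=\delta_{st}$ for $s,t\in S$, where $\delta_s$ is the point mass at $s$. Pseudo-amenability: for a Banach algebra $A$, let $A\hat{\otimes}A$ be the completed projective tensor product, with the $A$-bimodule structure determined by $a\cdot(b\otimes c)=ab\otimes c$ and $(b\otimes c)\cdot a=b\otimes ca$, and let $\pi:A\hat{\otimes}A\to A$ be the diagonal map, the continuous bimodule homomorphism determined by $\pi(a\otimes b)=ab$. $A$ is called pseudo-amenable if there is a net $(n_i)$ in $A\hat{\otimes}A$ (not required to be bounded), called an approximate diagonal for $A$, such that $a\cdot n_i-n_i\cdot a\to 0$ and $\pi(n_i)a\to a$ in norm for each $a\in A$. *)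

theory Defs
  imports "HOL-Analysis.Infinite_Sum" "HOL-Analysis.Elementary_Metric_Spaces"
begin

section \<open>Complex Banach spaces and algebras\<close>

class scaleC =
  fixes scaleC :: "complex \<Rightarrow> 'a \<Rightarrow> 'a"  (infixr "*\<^sub>C" 75)

class complex_normed_vector = real_normed_vector + scaleC +
  assumes scaleC_add_right: "a *\<^sub>C (x + y) = a *\<^sub>C x + a *\<^sub>C y"
    and scaleC_add_left: "(a + b) *\<^sub>C x = a *\<^sub>C x + b *\<^sub>C x"
    and scaleC_scaleC: "a *\<^sub>C b *\<^sub>C x = (a * b) *\<^sub>C x"
    and scaleC_of_real: "complex_of_real r *\<^sub>C x = r *\<^sub>R x"
    and norm_scaleC: "norm (a *\<^sub>C x) = cmod a * norm x"

class complex_banach = complex_normed_vector + banach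

class complex_banach_algebra = real_normed_algebra + complex_banach +
  assumes mult_scaleC_left: "(a *\<^sub>C x) * y = a *\<^sub>C (x * y)"
    and mult_scaleC_right: "x * (a *\<^sub>C y) = a *\<^sub>C (x * y)"

instantiation complex :: complex_banach_algebra
begin

definition scaleC_complex :: "complex \<Rightarrow> complex \<Rightarrow> complex"
  where "scaleC_complex = (*)"

instance
  by standard
    (simp_all add: scaleC_complex_def algebra_simps scaleR_conv_of_real norm_mult)

end

definition bounded_clinear ::
    "('a::complex_normed_vector \<Rightarrow> 'b::complex_normed_vector) \<Rightarrow> bool"
  where "bounded_clinear f \<longleftrightarrow> bounded_linear f \<and> (\<forall>c x. f (c *\<^sub>C x) = c *\<^sub>C f x)"

definition bounded_cbilinear ::
    "('a::complex_normed_vector \<Rightarrow> 'b::complex_normed_vector \<Rightarrow> 'c::complex_normed_vector) \<Rightarrow> bool"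
  where "bounded_cbilinear B \<longleftrightarrow> bounded_bilinear B \<and>
    (\<forall>c x y. B (c *\<^sub>C x) y = c *\<^sub>C B x y \<and> B x (c *\<^sub>C y) = c *\<^sub>C B x y)"

lemma bounded_clinear_add: "bounded_clinear f \<Longrightarrow> f (x + y) = f x + f y"
  and bounded_clinear_diff: "bounded_clinear f \<Longrightarrow> f (x - y) = f x - f y"
  by (auto simp: bounded_clinear_def bounded_linear.linear linear_add linear_diff)

lemma bounded_clinear_compose_bilinear:
  assumes "bounded_clinear f" "bounded_cbilinear B"
  shows "bounded_cbilinear (\<lambda>x y. f (B x y))"
proof -
  interpret f: bounded_linear f using assms by (simp add: bounded_clinear_def)
  interpret B: bounded_bilinear B using assms by (simp add: bounded_cbilinear_def)
  obtain K where K: "\<And>x y. norm (B x y) \<le> norm x * norm y * K"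
    using B.bounded by blast
  obtain L where L: "0 \<le> L" "\<And>z. norm (f z) \<le> norm z * L"
    using f.nonneg_bounded by blast
  have "norm (f (B x y)) \<le> norm x * norm y * (K * L)" for x y
    using order_trans[OF L(2) mult_right_mono[OF K L(1)]] by (simp add: mult.assoc)
  then have "bounded_bilinear (\<lambda>x y. f (B x y))"
    by unfold_locales
      (auto simp: B.add_left B.add_right B.scaleR_left B.scaleR_right f.add f.scaleR)
  then show ?thesis
    using assms by (auto simp: bounded_clinear_def bounded_cbilinear_def)
qed

lemma Cauchy_convergent_if_norm_summable:
  fixes X :: "nat \<Rightarrow> 'a::real_normed_vector"
  assumes complete: "\<And>u :: nat \<Rightarrow> 'a. summable (\<lambda>n. norm (u n)) \<Longrightarrow> summable u"
    and "Cauchy X"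
  shows "convergent X"
proof -
  have "\<exists>N. \<forall>m\<ge>N. \<forall>n\<ge>N. norm (X m - X n) < (1/2) ^ k" for k
    using \<open>Cauchy X\<close> unfolding Cauchy_def dist_norm by (metis zero_less_divide_1_iff zero_less_numeral zero_less_power)
  then obtain N where N: "\<And>k m n. m \<ge> N k \<Longrightarrow> n \<ge> N k \<Longrightarrow> norm (X m - X n) < (1/2) ^ k"
    by metis
  define r where "r = rec_nat (N 0) (\<lambda>k m. max (Suc m) (N (Suc k)))"
  have r_Suc: "r (Suc k) = max (Suc (r k)) (N (Suc k))" and r_0: "r 0 = N 0" for k
    by (auto simp: r_def)
  have mono: "strict_mono r"
    by (auto simp: strict_mono_Suc_iff r_Suc)
  have rN: "r k \<ge> N k" for k
    by (cases k) (auto simp: r_0 r_Suc)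
  have "norm (X (r (Suc k)) - X (r k)) \<le> (1/2) ^ k" for k
    using N[of k "r (Suc k)" "r k"] rN[of k] strict_monoD[OF mono, of k "Suc k"] by force
  then have "summable (\<lambda>k. norm (X (r (Suc k)) - X (r k)))"
    by (intro summable_comparison_test[OF _ summable_geometric[of "1/2::real"]]) auto
  then have "summable (\<lambda>k. X (r (Suc k)) - X (r k))"
    by (rule complete)
  then have "convergent (\<lambda>n. \<Sum>k<n. X (r (Suc k)) - X (r k))"
    by (simp add: summable_iff_convergent)
  then have "convergent (\<lambda>n. X (r n) - X (r 0))"
    using sum_lessThan_telescope[of "\<lambda>k. X (r k)"] by simp
  then have "convergent (\<lambda>n. (X (r n) - X (r 0)) + X (r 0))"
    by (intro convergent_add convergent_const)
  then obtain l where "(X \<circ> r) \<longlonglongrightarrow> l"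
    by (auto simp: convergent_def o_def)
  then have "X \<longlonglongrightarrow> l"
    using Cauchy_converges_subseq[OF \<open>Cauchy X\<close> mono] by blast
  then show ?thesis
    by (auto simp: convergent_def)
qed

lemma suminf_tail_tendsto_0:
  fixes f :: "nat \<Rightarrow> 'a::real_normed_vector"
  assumes "summable f"
  shows "(\<lambda>n. \<Sum>k. f (k + n)) \<longlonglongrightarrow> 0"
  using tendsto_diff[OF tendsto_const[of "suminf f"] summable_LIMSEQ[OF assms]]
  by (simp add: suminf_minus_initial_segment[OF assms])

subsection \<open>Bounded functionals separate points\<close>

definition sublinear :: "('a::real_vector \<Rightarrow> real) \<Rightarrow> bool"
  where "sublinear p \<longleftrightarrow>
    (\<forall>x y. p (x + y) \<le> p x + p y) \<and> (\<forall>t x. 0 \<le> t \<longrightarrow> p (t *\<^sub>R x) = t * p x)"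

lemma sublinear_minus: "sublinear p \<Longrightarrow> - p (- x) \<le> p x"
proof -
  assume p: "sublinear p"
  then have "p (0 *\<^sub>R x) = 0 * p x"
    unfolding sublinear_def by blast
  moreover have "p (x + - x) \<le> p x + p (- x)"
    using p unfolding sublinear_def by blast
  ultimately show ?thesis by simp
qed

lemma sublinear_descend:
  fixes q :: "'a::real_vector \<Rightarrow> real"
  assumes q: "sublinear q"
  obtains q' where "sublinear q'" "\<And>x. q' x \<le> q x" "q' (- y) \<le> - q y"
proof -
  have add: "q (x + z) \<le> q x + q z" and scale: "0 \<le> t \<Longrightarrow> q (t *\<^sub>R x) = t * q x" for x z t
    using q by (auto simp: sublinear_def)
  define S where "S x = (\<lambda>t. q (x + t *\<^sub>R y) - t * q y) ` {0..}" for x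
  define q' where "q' x = Inf (S x)" for x
  have lb: "- q (- x) \<le> z" if z: "z \<in> S x" for x z
  proof -
    obtain t where t: "0 \<le> t" "z = q (x + t *\<^sub>R y) - t * q y"
      using z by (auto simp: S_def)
    then show ?thesis
      using add[of "x + t *\<^sub>R y" "- x"] scale[of t y] by simp
  qed
  then have bdd: "bdd_below (S x)" for x
    by (meson bdd_belowI)
  have ne: "S x \<noteq> {}" for x
    by (auto simp: S_def)
  have le: "q' x \<le> q (x + t *\<^sub>R y) - t * q y" if "0 \<le> t" for x t
    unfolding q'_def using that by (intro cInf_lower bdd) (auto simp: S_def)
  have ge: "c \<le> q' x" if "\<And>t. 0 \<le> t \<Longrightarrow> c \<le> q (x + t *\<^sub>R y) - t * q y" for c x
    unfolding q'_def using that by (intro cInf_greatest ne) (auto simp: S_def)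
  have sub: "q' (x + z) \<le> q' x + q' z" for x z
  proof -
    have "q' (x + z) - (q (x + t *\<^sub>R y) - t * q y) \<le> q' z" if t: "0 \<le> t" for t
    proof (rule ge)
      fix s :: real assume s: "0 \<le> s"
      have "q' (x + z) \<le> q ((x + z) + (t + s) *\<^sub>R y) - (t + s) * q y"
        using t s by (intro le) auto
      also have "(x + z) + (t + s) *\<^sub>R y = (x + t *\<^sub>R y) + (z + s *\<^sub>R y)"
        by (simp add: algebra_simps)
      finally show "q' (x + z) - (q (x + t *\<^sub>R y) - t * q y) \<le> q (z + s *\<^sub>R y) - s * q y"
        using add[of "x + t *\<^sub>R y" "z + s *\<^sub>R y"] by (simp add: algebra_simps)
    qed
    then have "q' (x + z) - q' z \<le> q' x"
      by (intro ge) (simp add: algebra_simps)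
    then show ?thesis by simp
  qed
  have sc: "r * q' x \<ge> q' (r *\<^sub>R x)" if "0 < r" for r x
  proof -
    have "q' (r *\<^sub>R x) / r \<le> q' x"
    proof (rule ge)
      fix t :: real assume t: "0 \<le> t"
      have "q' (r *\<^sub>R x) \<le> q (r *\<^sub>R x + (r * t) *\<^sub>R y) - (r * t) * q y"
        using t that by (intro le) auto
      also have "r *\<^sub>R x + (r * t) *\<^sub>R y = r *\<^sub>R (x + t *\<^sub>R y)"
        by (simp add: algebra_simps)
      finally show "q' (r *\<^sub>R x) / r \<le> q (x + t *\<^sub>R y) - t * q y"
        using that scale[of r "x + t *\<^sub>R y"] by (simp add: field_simps)
    qed
    then show ?thesis using that by (simp add: field_simps)
  qed
  have scale': "q' (r *\<^sub>R x) = r * q' x" if "0 \<le> r" for r x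
  proof (cases "r = 0")
    case True
    have "q' 0 = 0"
    proof (rule antisym)
      show "q' 0 \<le> 0" using le[of 0 0] scale[of 0 0] by simp
      show "0 \<le> q' 0" using scale by (intro ge) auto
    qed
    with True show ?thesis by simp
  next
    case False
    with that have r: "0 < r" by simp
    have "q' ((1 / r) *\<^sub>R (r *\<^sub>R x)) \<le> (1 / r) * q' (r *\<^sub>R x)"
      using r by (intro sc) auto
    then have "r * q' x \<le> q' (r *\<^sub>R x)"
      using r by (simp add: field_simps)
    with sc[OF r] show ?thesis by (simp add: antisym)
  qed
  show ?thesis
  proof (rule that)
    show "sublinear q'" using sub scale' by (auto simp: sublinear_def)
    show "q' x \<le> q x" for x using le[of 0 x] by simp
    show "q' (- y) \<le> - q y" using le[of 1 "- y"] scale[of 0 0] by simp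
  qed
qed

lemma sublinear_supporting_linear:
  fixes p :: "'a::real_vector \<Rightarrow> real"
  assumes p: "sublinear p"
  obtains f where "linear f" "\<And>x. f x \<le> p x" "f y = p y"
proof -
  obtain p' where p': "sublinear p'" "\<And>x. p' x \<le> p x" "p' (- y) \<le> - p y"
    using sublinear_descend[OF p, of y] by metis
  define A where "A = {q. sublinear q \<and> q \<le> p'}"
  have "\<exists>m\<in>A. \<forall>a\<in>A. a \<le> m \<longrightarrow> a = m"
  proof (rule predicate_Zorn)
    show "partial_order_on A (relation_of (\<lambda>q r. r \<le> q) A)"
      by (rule partial_order_on_relation_ofI) auto
  next
    fix C assume C: "C \<in> Chains (relation_of (\<lambda>q r. r \<le> q) A)"
    then have CA: "C \<subseteq> A" and tot: "\<And>q r. q \<in> C \<Longrightarrow> r \<in> C \<Longrightarrow> q \<le> r \<or> r \<le> q"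
      by (auto simp: Chains_def relation_of_def)
    show "\<exists>u\<in>A. \<forall>a\<in>C. u \<le> a"
    proof (cases "C = {}")
      case True
      with p' show ?thesis by (auto simp: A_def)
    next
      case False
      define u where "u x = Inf ((\<lambda>q. q x) ` C)" for x
      have lb: "- p' (- x) \<le> q x" if "q \<in> C" for q x
      proof -
        have "q \<in> A" using that CA by auto
        then have "- q (- x) \<le> q x" "q (- x) \<le> p' (- x)"
          using sublinear_minus[of q x] by (auto simp: A_def le_fun_def)
        then show ?thesis by simp
      qed
      then have bdd: "bdd_below ((\<lambda>q. q x) ` C)" for x
        by (intro bdd_belowI[of _ "- p' (- x)"]) auto
      have le: "u x \<le> q x" if "q \<in> C" for q x
        unfolding u_def using that bdd by (intro cInf_lower) auto
      have ge: "c \<le> u x" if "\<And>q. q \<in> C \<Longrightarrow> c \<le> q x" for c x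
        unfolding u_def using that False by (intro cInf_greatest) auto
      have subl: "q (x + z) \<le> q x + q z" "0 \<le> t \<Longrightarrow> q (t *\<^sub>R x) = t * q x" if "q \<in> C" for q x z t
        using that CA by (auto simp: A_def sublinear_def)
      have add: "u (x + z) \<le> u x + u z" for x z
      proof -
        have *: "u (x + z) \<le> q x + r z" if qr: "q \<in> C" "r \<in> C" for q r
        proof (cases "q \<le> r")
          case True
          then show ?thesis
            using le[OF qr(1), of "x + z"] subl(1)[OF qr(1), of x z] by (auto simp: le_fun_def intro: order_trans)
        next
          case False
          then have "r \<le> q" using tot qr by blast
          then show ?thesis
            using le[OF qr(2), of "x + z"] subl(1)[OF qr(2), of x z]
            by (smt (verit) le_fun_def)
        qed
        have "u (x + z) - q x \<le> u z" if "q \<in> C" for q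
          using *[OF that] by (intro ge) (auto simp: algebra_simps)
        then have "u (x + z) - u z \<le> u x"
          by (intro ge) (auto simp: algebra_simps)
        then show ?thesis by simp
      qed
      have scale: "u (t *\<^sub>R x) = t * u x" if t: "0 \<le> t" for t x
      proof (cases "t = 0")
        case True
        have "(\<lambda>q. q (0::'a)) ` C = {0}"
          using False subl(2)[of _ 0 0] by force
        with True show ?thesis by (simp add: u_def)
      next
        case ne: False
        with t have t: "0 < t" by simp
        show ?thesis
        proof (rule antisym)
          have "u (t *\<^sub>R x) / t \<le> u x"
          proof (rule ge)
            fix q assume "q \<in> C"
            then show "u (t *\<^sub>R x) / t \<le> q x"
              using le[of q "t *\<^sub>R x"] subl(2)[of q t x] t by (simp add: field_simps)
          qed
          then show "u (t *\<^sub>R x) \<le> t * u x" using t by (simp add: field_simps)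
          show "t * u x \<le> u (t *\<^sub>R x)"
          proof (rule ge)
            fix q assume "q \<in> C"
            then show "t * u x \<le> q (t *\<^sub>R x)"
              using le[of q x] subl(2)[of q t x] t by simp
          qed
        qed
      qed
      obtain q where "q \<in> C" using False by auto
      then have "u \<le> p'"
        using le[of q] CA by (force simp: A_def le_fun_def intro: order_trans)
      with add scale have "u \<in> A" by (auto simp: A_def sublinear_def)
      with le show ?thesis by (auto simp: le_fun_def)
    qed
  qed
  then obtain m where m: "sublinear m" "m \<le> p'" and min: "\<And>q. q \<in> A \<Longrightarrow> q \<le> m \<Longrightarrow> q = m"
    by (auto simp: A_def)
  have neg: "m (- x) = - m x" for x
  proof -
    obtain q where q: "sublinear q" "\<And>z. q z \<le> m z" "q (- x) \<le> - m x"
      using sublinear_descend[OF m(1), of x] by metis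
    then have "q = m"
      using m(2) by (intro min) (auto simp: A_def le_fun_def intro: order_trans)
    with q(3) sublinear_minus[OF m(1), of x] show ?thesis by simp
  qed
  have add: "m (x + z) = m x + m z" for x z
  proof (rule antisym)
    show "m (x + z) \<le> m x + m z" using m(1) by (simp add: sublinear_def)
    have "m (- x + - z) \<le> m (- x) + m (- z)" using m(1) unfolding sublinear_def by blast
    then show "m x + m z \<le> m (x + z)" using neg[of x] neg[of z] neg[of "x + z"] by simp
  qed
  have scale: "m (t *\<^sub>R x) = t *\<^sub>R m x" for t x
  proof (cases "0 \<le> t")
    case True
    then show ?thesis using m(1) by (simp add: sublinear_def)
  next
    case False
    then have "m ((- t) *\<^sub>R x) = (- t) * m x"
      using m(1) unfolding sublinear_def by (meson linear neg_0_le_iff_le)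
    then show ?thesis using neg[of "t *\<^sub>R x"] by simp
  qed
  have mp: "m x \<le> p x" for x
    using m(2) p'(2)[of x] by (auto simp: le_fun_def intro: order_trans)
  have "m (- y) \<le> - p y"
    using m(2) p'(3) by (auto simp: le_fun_def intro: order_trans)
  then have "m y = p y"
    using neg[of y] mp[of y] by simp
  moreover have "linear m" using add scale by (intro linearI) auto
  ultimately show ?thesis using mp that by blast
qed

lemma scaleC_1 [simp]: "1 *\<^sub>C x = (x::'a::complex_normed_vector)"
  using scaleC_of_real[of 1 x] by simp

lemma separating_functional:
  fixes z :: "'a::complex_normed_vector"
  assumes "z \<noteq> 0"
  obtains f :: "'a \<Rightarrow> complex" where "bounded_clinear f" "f z \<noteq> 0"
proof -
  have "sublinear (norm :: 'a \<Rightarrow> real)"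
    by (auto simp: sublinear_def norm_triangle_ineq)
  then obtain g :: "'a \<Rightarrow> real"
    where g: "linear g" and le: "\<And>x. g x \<le> norm x" and gz: "g z = norm z"
    using sublinear_supporting_linear by metis
  have abs: "\<bar>g x\<bar> \<le> norm x" for x
    using le[of x] le[of "- x"] linear_neg[OF g, of x] by simp
  define f where "f x = Complex (g x) (- g (\<i> *\<^sub>C x))" for x
  have "bounded_linear f"
  proof (rule bounded_linear_intro[where K = 2])
    show "f (x + y) = f x + f y" for x y
      by (simp add: f_def complex_eq_iff scaleC_add_right linear_add[OF g])
    have "\<i> *\<^sub>C (r *\<^sub>R x) = r *\<^sub>R (\<i> *\<^sub>C x)" for r and x :: 'a
      by (metis mult.commute scaleC_of_real scaleC_scaleC)
    then show "f (r *\<^sub>R x) = r *\<^sub>R f x" for r x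
      by (simp add: f_def complex_eq_iff linear_scale[OF g])
    show "norm (f x) \<le> norm x * 2" for x
      using cmod_le[of "f x"] abs[of x] abs[of "\<i> *\<^sub>C x"] by (simp add: f_def norm_scaleC)
  qed
  moreover have "f (c *\<^sub>C x) = c *\<^sub>C f x" for c x
  proof -
    have split: "g (d *\<^sub>C w) = Re d * g w + Im d * g (\<i> *\<^sub>C w)" for d w
    proof -
      have "d *\<^sub>C w = (of_real (Re d) + of_real (Im d) * \<i>) *\<^sub>C w"
        by (metis complex_eq mult.commute)
      also have "\<dots> = Re d *\<^sub>R w + Im d *\<^sub>R (\<i> *\<^sub>C w)"
        by (simp add: scaleC_add_left flip: scaleC_scaleC scaleC_of_real)
      finally show ?thesis
        by (simp add: linear_add[OF g] linear_scale[OF g])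
    qed
    show ?thesis
      unfolding f_def
      by (simp add: scaleC_scaleC split[of c] split[of "\<i> * c"] scaleC_complex_def complex_eq_iff algebra_simps)
  qed
  ultimately have "bounded_clinear f" by (simp add: bounded_clinear_def)
  moreover have "f z \<noteq> 0" using assms gz by (simp add: f_def complex_eq_iff)
  ultimately show ?thesis by (rule that)
qed

section \<open>The semigroup algebra\<close>

typedef 's l1 = "{f :: 's \<Rightarrow> complex. f abs_summable_on UNIV}"
  morphisms l1_fun Abs_l1
  by (rule exI[of _ "\<lambda>_. 0"]) simp

setup_lifting type_definition_l1

lemma l1_fun_abs_summable: "l1_fun f abs_summable_on UNIV"
  using l1_fun by blast

lemma l1_fun_summable: "l1_fun f summable_on UNIV"
  by (rule abs_summable_summable[OF l1_fun_abs_summable])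

lemma l1_eqI: "(\<And>s. l1_fun f s = l1_fun g s) \<Longrightarrow> f = g"
  by (simp add: l1_fun_inject[symmetric] fun_eq_iff)

lemma abs_summable_add:
  fixes f g :: "'s \<Rightarrow> 'b::real_normed_vector"
  assumes "f abs_summable_on A" "g abs_summable_on A"
  shows "(\<lambda>x. f x + g x) abs_summable_on A"
  by (rule summable_on_comparison_test[OF summable_on_add[OF assms]])
    (auto simp: norm_triangle_ineq)

instantiation l1 :: (type) complex_normed_vector
begin

lift_definition zero_l1 :: "'a l1" is "\<lambda>_. 0" by simp

lift_definition plus_l1 :: "'a l1 \<Rightarrow> 'a l1 \<Rightarrow> 'a l1" is "\<lambda>f g s. f s + g s"
  by (rule abs_summable_add)

lift_definition uminus_l1 :: "'a l1 \<Rightarrow> 'a l1" is "\<lambda>f s. - f s"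
  by simp

lift_definition minus_l1 :: "'a l1 \<Rightarrow> 'a l1 \<Rightarrow> 'a l1" is "\<lambda>f g s. f s - g s"
  subgoal for f g
    using abs_summable_add[of f UNIV "\<lambda>s. - g s"] by simp
  done

lift_definition scaleR_l1 :: "real \<Rightarrow> 'a l1 \<Rightarrow> 'a l1" is "\<lambda>r f s. r *\<^sub>R f s"
  by (simp add: summable_on_cmult_right)

lift_definition scaleC_l1 :: "complex \<Rightarrow> 'a l1 \<Rightarrow> 'a l1" is "\<lambda>c f s. c * f s"
  by (simp add: norm_mult summable_on_cmult_right)

definition norm_l1 :: "'a l1 \<Rightarrow> real"
  where "norm_l1 f = (\<Sum>\<^sub>\<infinity>s. cmod (l1_fun f s))"

definition sgn_l1 :: "'a l1 \<Rightarrow> 'a l1"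
  where "sgn_l1 f = inverse (norm f) *\<^sub>R f"

definition dist_l1 :: "'a l1 \<Rightarrow> 'a l1 \<Rightarrow> real"
  where "dist_l1 f g = norm (f - g)"

definition uniformity_l1 :: "('a l1 \<times> 'a l1) filter"
  where "uniformity_l1 = (INF e\<in>{0<..}. principal {(f, g). dist f g < e})"

definition open_l1 :: "'a l1 set \<Rightarrow> bool"
  where "open_l1 U = (\<forall>f\<in>U. \<forall>\<^sub>F (g, h) in uniformity. g = f \<longrightarrow> h \<in> U)"

instance
proof
  fix f g h :: "'a l1" and a b :: complex and r q :: real
  show "f + g + h = f + (g + h)" "f + g = g + f" "0 + f = f" "- f + f = 0" "f - g = f + - g"
    "r *\<^sub>R (f + g) = r *\<^sub>R f + r *\<^sub>R g" "(r + q) *\<^sub>R f = r *\<^sub>R f + q *\<^sub>R f"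
    "r *\<^sub>R q *\<^sub>R f = (r * q) *\<^sub>R f" "1 *\<^sub>R f = f"
    "a *\<^sub>C (f + g) = a *\<^sub>C f + a *\<^sub>C g" "(a + b) *\<^sub>C f = a *\<^sub>C f + b *\<^sub>C f"
    "a *\<^sub>C b *\<^sub>C f = (a * b) *\<^sub>C f" "complex_of_real r *\<^sub>C f = r *\<^sub>R f"
    by (transfer; simp add: algebra_simps scaleR_conv_of_real)+
  show "norm f = 0 \<longleftrightarrow> f = 0"
  proof
    assume "norm f = 0"
    then have "cmod (l1_fun f s) = 0" for s
      using nonneg_infsum_le_0D[OF _ l1_fun_abs_summable[of f], of s] by (simp add: norm_l1_def)
    then show "f = 0" by (intro l1_eqI) (simp add: zero_l1.rep_eq)
  qed (simp add: norm_l1_def zero_l1.rep_eq)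
  show "norm (f + g) \<le> norm f + norm g"
    unfolding norm_l1_def plus_l1.rep_eq
    by (subst infsum_add[symmetric])
      (auto intro!: infsum_mono abs_summable_add summable_on_add l1_fun_abs_summable norm_triangle_ineq)
  show "norm (r *\<^sub>R f) = \<bar>r\<bar> * norm f"
    by (simp add: norm_l1_def scaleR_l1.rep_eq infsum_cmult_right')
  show "norm (a *\<^sub>C f) = cmod a * norm f"
    by (simp add: norm_l1_def scaleC_l1.rep_eq norm_mult infsum_cmult_right')
qed (simp_all add: sgn_l1_def dist_l1_def uniformity_l1_def open_l1_def)

end

lemma norm_l1_fun_le: "cmod (l1_fun f s) \<le> norm f"
  using finite_sum_le_infsum[OF l1_fun_abs_summable[of f], of "{s}"] by (simp add: norm_l1_def)

lemma l1_absolutely_convergent: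
  fixes u :: "nat \<Rightarrow> 's l1"
  assumes u: "summable (\<lambda>n. norm (u n))"
  shows "summable u"
proof -
  have row: "(\<lambda>s. cmod (l1_fun (u n) s)) summable_on UNIV" for n
    by (rule l1_fun_abs_summable)
  have nrm: "(\<lambda>n. norm (u n)) summable_on UNIV"
    using u by (intro norm_summable_imp_summable_on) simp
  have "(\<lambda>(n, s). l1_fun (u n) s) abs_summable_on (UNIV \<times> UNIV)"
    unfolding abs_summable_on_Sigma_iff using nrm
    by (simp add: norm_l1_def[symmetric] l1_fun_abs_summable)
  then have joint: "(\<lambda>(n, s). cmod (l1_fun (u n) s)) summable_on (UNIV \<times> UNIV)"
    by (simp add: case_prod_unfold)
  then have joint': "(\<lambda>(s, n). cmod (l1_fun (u n) s)) summable_on (UNIV \<times> UNIV)"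
    by (subst (asm) summable_on_swap) simp
  have col: "(\<lambda>n. cmod (l1_fun (u n) s)) summable_on UNIV" for s
    using summable_on_SigmaD1[OF joint', of s] by simp
  then have colC: "(\<lambda>n. l1_fun (u n) s) summable_on UNIV" for s
    by (rule abs_summable_summable)
  define f where "f s = (\<Sum>\<^sub>\<infinity>n. l1_fun (u n) s)" for s
  have f_abs: "f abs_summable_on UNIV"
  proof (rule summable_on_comparison_test)
    show "(\<lambda>s. \<Sum>\<^sub>\<infinity>n. cmod (l1_fun (u n) s)) summable_on UNIV"
      using summable_on_Sigma_banach[OF joint'] by simp
  qed (auto simp: f_def norm_infsum_bound col)
  define F where "F = Abs_l1 f"
  have F: "l1_fun F = f" unfolding F_def using f_abs by (simp add: Abs_l1_inverse)
  have sum_fun: "l1_fun (\<Sum>k<n. u k) s = (\<Sum>k<n. l1_fun (u k) s)" for n s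
    by (induction n) (simp_all add: zero_l1.rep_eq plus_l1.rep_eq)
  have tail: "norm (F - (\<Sum>k<n. u k)) \<le> (\<Sum>k. norm (u (k + n)))" for n
  proof -
    have shift: "f s - (\<Sum>k<n. l1_fun (u k) s) = (\<Sum>\<^sub>\<infinity>k\<in>{n..}. l1_fun (u k) s)" for s
    proof -
      have "f s = (\<Sum>\<^sub>\<infinity>k\<in>{..<n} \<union> {n..}. l1_fun (u k) s)"
        unfolding f_def by (rule arg_cong2[where f = infsum]) auto
      also have "\<dots> = (\<Sum>\<^sub>\<infinity>k\<in>{..<n}. l1_fun (u k) s) + (\<Sum>\<^sub>\<infinity>k\<in>{n..}. l1_fun (u k) s)"
        by (rule infsum_Un_disjoint) (auto intro: summable_on_subset[OF colC])
      finally show ?thesis by simp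
    qed
    have jn: "(\<lambda>(s, k). cmod (l1_fun (u k) s)) summable_on (UNIV \<times> {n..})"
      by (rule summable_on_subset[OF joint']) auto
    have "norm (F - (\<Sum>k<n. u k)) = (\<Sum>\<^sub>\<infinity>s. cmod (\<Sum>\<^sub>\<infinity>k\<in>{n..}. l1_fun (u k) s))"
      by (simp add: norm_l1_def minus_l1.rep_eq F sum_fun shift)
    also have "\<dots> \<le> (\<Sum>\<^sub>\<infinity>s. \<Sum>\<^sub>\<infinity>k\<in>{n..}. cmod (l1_fun (u k) s))"
    proof (rule infsum_mono)
      show "(\<lambda>s. cmod (\<Sum>\<^sub>\<infinity>k\<in>{n..}. l1_fun (u k) s)) summable_on UNIV"
        using l1_fun_abs_summable[of "F - (\<Sum>k<n. u k)"]
        by (simp add: minus_l1.rep_eq F sum_fun shift)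
      show "(\<lambda>s. \<Sum>\<^sub>\<infinity>k\<in>{n..}. cmod (l1_fun (u k) s)) summable_on UNIV"
        using summable_on_Sigma_banach[OF jn] by simp
      show "cmod (\<Sum>\<^sub>\<infinity>k\<in>{n..}. l1_fun (u k) s) \<le> (\<Sum>\<^sub>\<infinity>k\<in>{n..}. cmod (l1_fun (u k) s))" for s
        by (rule norm_infsum_bound[OF summable_on_subset[OF col]]) auto
    qed
    also have "\<dots> = (\<Sum>\<^sub>\<infinity>k\<in>{n..}. \<Sum>\<^sub>\<infinity>s. cmod (l1_fun (u k) s))"
      by (rule infsum_swap_banach) (use jn in simp)
    also have "\<dots> = (\<Sum>\<^sub>\<infinity>k\<in>{n..}. norm (u k))"
      by (simp add: norm_l1_def)
    also have "\<dots> = (\<Sum>\<^sub>\<infinity>k. norm (u (k + n)))"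
      by (rule infsum_reindex_bij_witness[of _ "\<lambda>k. k + n" "\<lambda>k. k - n"]) auto
    also have "\<dots> = (\<Sum>k. norm (u (k + n)))"
    proof -
      have "(\<lambda>k. norm (u (k + n))) summable_on UNIV"
        using u by (intro norm_summable_imp_summable_on) (simp add: summable_iff_shift[where f = "\<lambda>k. norm (u k)"])
      then show ?thesis
        using has_sum_imp_sums[OF has_sum_infsum] by (metis sums_unique)
    qed
    finally show ?thesis .
  qed
  have "(\<lambda>n. \<Sum>k. norm (u (k + n))) \<longlonglongrightarrow> 0"
    by (rule suminf_tail_tendsto_0[OF u])
  then have "(\<lambda>n. norm (F - (\<Sum>k<n. u k))) \<longlonglongrightarrow> 0"
    by (rule tendsto_sandwich[OF _ _ tendsto_const, rotated 2]) (use tail in auto)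
  then have "(\<lambda>n. norm ((\<Sum>k<n. u k) - F)) \<longlonglongrightarrow> 0"
    by (simp add: norm_minus_commute)
  then have "(\<lambda>n. \<Sum>k<n. u k) \<longlonglongrightarrow> F"
    by (rule LIM_zero_cancel[OF tendsto_norm_zero_cancel])
  then show ?thesis
    by (auto simp: summable_iff_convergent convergent_def)
qed

instance l1 :: (type) complex_banach
  by standard (rule Cauchy_convergent_if_norm_summable[OF l1_absolutely_convergent])

lemma
  fixes h :: "'x \<Rightarrow> 'b::banach" and m :: "'x \<Rightarrow> 's"
  assumes h: "h summable_on UNIV"
  shows fiber_sum_summable: "(\<lambda>s. \<Sum>\<^sub>\<infinity>x\<in>{x. m x = s}. h x) summable_on UNIV"
    and fiber_sum_infsum: "(\<Sum>\<^sub>\<infinity>s. \<Sum>\<^sub>\<infinity>x\<in>{x. m x = s}. h x) = (\<Sum>\<^sub>\<infinity>x. h x)"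
proof -
  have bij: "bij_betw snd (Sigma UNIV (\<lambda>s. {x. m x = s})) UNIV"
    by (rule bij_betwI[where g = "\<lambda>x. (m x, x)"]) auto
  have *: "(\<lambda>(s, x). h x) summable_on Sigma UNIV (\<lambda>s. {x. m x = s})"
    using summable_on_reindex_bij_betw[OF bij, of h] h by (simp add: case_prod_unfold)
  show "(\<lambda>s. \<Sum>\<^sub>\<infinity>x\<in>{x. m x = s}. h x) summable_on UNIV"
    using summable_on_Sigma_banach[OF *] by simp
  show "(\<Sum>\<^sub>\<infinity>s. \<Sum>\<^sub>\<infinity>x\<in>{x. m x = s}. h x) = (\<Sum>\<^sub>\<infinity>x. h x)"
    using infsum_Sigma'_banach[OF *] infsum_reindex_bij_betw[OF bij, of h]
    by (simp add: case_prod_unfold)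
qed

lemma abs_summable_times:
  fixes f :: "'s \<Rightarrow> complex" and g :: "'t \<Rightarrow> complex"
  assumes "f abs_summable_on UNIV" "g abs_summable_on UNIV"
  shows "(\<lambda>(x, y). f x * g y) abs_summable_on UNIV"
    and "(\<Sum>\<^sub>\<infinity>p. cmod (case p of (x, y) \<Rightarrow> f x * g y)) = (\<Sum>\<^sub>\<infinity>x. cmod (f x)) * (\<Sum>\<^sub>\<infinity>y. cmod (g y))"
proof -
  have *: "(\<lambda>(x, y). f x * g y) abs_summable_on UNIV \<times> UNIV"
    unfolding abs_summable_on_Sigma_iff using assms
    by (auto simp: norm_mult infsum_cmult_right' summable_on_cmult_right summable_on_cmult_left
        abs_mult infsum_nonneg)
  then show "(\<lambda>(x, y). f x * g y) abs_summable_on UNIV" by simp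
  have "(\<Sum>\<^sub>\<infinity>p. cmod (case p of (x, y) \<Rightarrow> f x * g y)) = (\<Sum>\<^sub>\<infinity>x. \<Sum>\<^sub>\<infinity>y. cmod (f x * g y))"
    using infsum_Sigma_banach[OF *] by simp
  then show "(\<Sum>\<^sub>\<infinity>p. cmod (case p of (x, y) \<Rightarrow> f x * g y)) = (\<Sum>\<^sub>\<infinity>x. cmod (f x)) * (\<Sum>\<^sub>\<infinity>y. cmod (g y))"
    by (simp add: norm_mult infsum_cmult_right' infsum_cmult_left')
qed

definition convolution :: "('s::semigroup_mult \<Rightarrow> complex) \<Rightarrow> ('s \<Rightarrow> complex) \<Rightarrow> 's \<Rightarrow> complex"
  where "convolution f g s = (\<Sum>\<^sub>\<infinity>(t, u)\<in>{(t, u). t * u = s}. f t * g u)"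

lemma convolution_alt:
  "convolution f g s = (\<Sum>\<^sub>\<infinity>p\<in>{p. (case p of (t, u) \<Rightarrow> t * u) = s}. case p of (t, u) \<Rightarrow> f t * g u)"
  by (simp add: convolution_def case_prod_unfold)

lemma convolution_abs_summable:
  assumes "f abs_summable_on UNIV" "g abs_summable_on UNIV"
  shows "convolution f g abs_summable_on UNIV"
    and "(\<Sum>\<^sub>\<infinity>s. cmod (convolution f g s)) \<le> (\<Sum>\<^sub>\<infinity>s. cmod (f s)) * (\<Sum>\<^sub>\<infinity>s. cmod (g s))"
proof -
  let ?F = "\<lambda>p. case p of (t, u) \<Rightarrow> f t * g u" and ?m = "\<lambda>p::'a \<times> 'a. case p of (t, u) \<Rightarrow> t * u"
  note F = abs_summable_times[OF assms]
  have le: "cmod (convolution f g s) \<le> (\<Sum>\<^sub>\<infinity>p\<in>{p. ?m p = s}. cmod (?F p))" for s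
    unfolding convolution_alt by (rule norm_infsum_bound[OF summable_on_subset[OF F(1)]]) auto
  show 1: "convolution f g abs_summable_on UNIV"
    using le by (intro summable_on_comparison_test[OF fiber_sum_summable[OF F(1), of ?m]]) auto
  have "(\<Sum>\<^sub>\<infinity>s. cmod (convolution f g s)) \<le> (\<Sum>\<^sub>\<infinity>s. \<Sum>\<^sub>\<infinity>p\<in>{p. ?m p = s}. cmod (?F p))"
    by (rule infsum_mono[OF 1 fiber_sum_summable[OF F(1), of ?m] le])
  then show "(\<Sum>\<^sub>\<infinity>s. cmod (convolution f g s)) \<le> (\<Sum>\<^sub>\<infinity>s. cmod (f s)) * (\<Sum>\<^sub>\<infinity>s. cmod (g s))"
    using fiber_sum_infsum[OF F(1), of ?m] F(2) by simp
qed

lemma convolution_assoc: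
  assumes f: "f abs_summable_on UNIV" and g: "g abs_summable_on UNIV" and h: "h abs_summable_on UNIV"
  shows "convolution (convolution f g) h s = convolution f (convolution g h) s"
proof -
  have fgh: "(\<lambda>(x, y). f x * (case y of (b, c) \<Rightarrow> g b * h c)) abs_summable_on UNIV"
    by (rule abs_summable_times(1)[OF f abs_summable_times(1)[OF g h]])
  let ?F = "\<lambda>(a, b, c). f a * g b * h c"
  have F: "?F summable_on X" for X
  proof (rule summable_on_subset[OF _ subset_UNIV], rule abs_summable_summable)
    show "?F abs_summable_on UNIV"
      using fgh by (simp add: case_prod_unfold mult.assoc)
  qed
  let ?T = "{(a, b, c). a * b * c = s}"
  have "convolution (convolution f g) h s =
      (\<Sum>\<^sub>\<infinity>(p, c)\<in>{(p, c). p * c = s}. \<Sum>\<^sub>\<infinity>(a, b)\<in>{(a, b). a * b = p}. f a * g b * h c)"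
    by (simp add: convolution_def infsum_cmult_left'[symmetric] case_prod_unfold)
  also have "\<dots> = (\<Sum>\<^sub>\<infinity>((p, c), (a, b))\<in>(SIGMA (p, c):{(p, c). p * c = s}. {(a, b). a * b = p}). f a * g b * h c)"
  proof -
    have "(\<lambda>(x, y). case x of (p, c) \<Rightarrow> case y of (a, b) \<Rightarrow> f a * g b * h c)
        summable_on (SIGMA (p, c):{(p, c). p * c = s}. {(a, b). a * b = p})"
      by (subst summable_on_reindex_bij_witness[of _ "\<lambda>(a, b, c). ((a * b, c), (a, b))"
            "\<lambda>((p, c), (a, b)). (a, b, c)" ?T ?F]) (auto intro: F)
    from infsum_Sigma'_banach[OF this] show ?thesis
      by (simp add: case_prod_unfold)
  qed
  also have "\<dots> = infsum ?F ?T"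
    by (rule infsum_reindex_bij_witness[of _ "\<lambda>(a, b, c). ((a * b, c), (a, b))"
            "\<lambda>((p, c), (a, b)). (a, b, c)"]) auto
  also have "\<dots> = (\<Sum>\<^sub>\<infinity>((a, q), (b, c))\<in>(SIGMA (a, q):{(a, q). a * q = s}. {(b, c). b * c = q}). f a * g b * h c)"
    by (rule infsum_reindex_bij_witness[of _ "\<lambda>((a, q), (b, c)). (a, b, c)"
            "\<lambda>(a, b, c). ((a, b * c), (b, c))"]) (auto simp: mult.assoc)
  also have "\<dots> = (\<Sum>\<^sub>\<infinity>(a, q)\<in>{(a, q). a * q = s}. \<Sum>\<^sub>\<infinity>(b, c)\<in>{(b, c). b * c = q}. f a * g b * h c)"
  proof -
    have "(\<lambda>(x, y). case x of (a, q) \<Rightarrow> case y of (b, c) \<Rightarrow> f a * g b * h c)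
        summable_on (SIGMA (a, q):{(a, q). a * q = s}. {(b, c). b * c = q})"
      by (subst summable_on_reindex_bij_witness[of _ "\<lambda>(a, b, c). ((a, b * c), (b, c))"
            "\<lambda>((a, q), (b, c)). (a, b, c)" ?T ?F]) (auto simp: mult.assoc intro: F[simplified mult.assoc])
    from infsum_Sigma'_banach[OF this] show ?thesis
      by (simp add: case_prod_unfold)
  qed
  also have "\<dots> = convolution f (convolution g h) s"
    by (simp add: convolution_def infsum_cmult_right'[symmetric] case_prod_unfold mult.assoc)
  finally show ?thesis .
qed

instantiation l1 :: (semigroup_mult) complex_banach_algebra
begin

lift_definition times_l1 :: "'a l1 \<Rightarrow> 'a l1 \<Rightarrow> 'a l1" is convolution
  by (rule convolution_abs_summable)

instance
proof
  fix f g h :: "'a l1" and c :: complex and r :: real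
  have F: "(\<lambda>(t, u). l1_fun f t * l1_fun g u) summable_on X" for f g :: "'a l1" and X
    by (rule summable_on_subset[OF abs_summable_summable[OF
          abs_summable_times(1)[OF l1_fun_abs_summable l1_fun_abs_summable]] subset_UNIV])
  show "f * g * h = f * (g * h)"
    by (rule l1_eqI) (simp add: times_l1.rep_eq convolution_assoc l1_fun_abs_summable)
  show "(f + g) * h = f * h + g * h"
    by (rule l1_eqI)
      (simp add: times_l1.rep_eq plus_l1.rep_eq convolution_def case_prod_unfold distrib_right
        infsum_add[OF F[unfolded case_prod_unfold] F[unfolded case_prod_unfold]])
  show "f * (g + h) = f * g + f * h"
    by (rule l1_eqI)
      (simp add: times_l1.rep_eq plus_l1.rep_eq convolution_def case_prod_unfold distrib_left
        infsum_add[OF F[unfolded case_prod_unfold] F[unfolded case_prod_unfold]])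
  have C: "(c *\<^sub>C f) * g = c *\<^sub>C (f * g)" "f * (c *\<^sub>C g) = c *\<^sub>C (f * g)" for c
    by (rule l1_eqI; simp add: times_l1.rep_eq scaleC_l1.rep_eq convolution_def case_prod_unfold
        infsum_cmult_right'[symmetric] algebra_simps)+
  then show "(c *\<^sub>C f) * g = c *\<^sub>C (f * g)" "f * (c *\<^sub>C g) = c *\<^sub>C (f * g)" by auto
  show "(r *\<^sub>R f) * g = r *\<^sub>R (f * g)" "f * (r *\<^sub>R g) = r *\<^sub>R (f * g)"
    using C[of "of_real r"] by (simp_all add: scaleC_of_real)
  show "norm (f * g) \<le> norm f * norm g"
    unfolding norm_l1_def times_l1.rep_eq
    by (rule convolution_abs_summable(2)[OF l1_fun_abs_summable l1_fun_abs_summable])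
qed

end

lift_definition point_mass :: "'s \<Rightarrow> 's l1" is "\<lambda>s t. if t = s then 1 else 0"
  subgoal for s
    by (subst summable_on_cong_neutral[where T = "{s}" and g = "\<lambda>_. 1"]) auto
  done

lemma point_mass_mult:
  fixes s t :: "'s::semigroup_mult"
  shows "point_mass s * point_mass t = point_mass (s * t)"
proof (rule l1_eqI)
  fix v
  have "(\<Sum>\<^sub>\<infinity>p\<in>{(x, y). x * y = v}. case p of (x, y) \<Rightarrow> l1_fun (point_mass s) x * l1_fun (point_mass t) y)
    = (\<Sum>\<^sub>\<infinity>p\<in>{(x, y). x * y = v} \<inter> {(s, t)}. 1)"
    by (rule infsum_cong_neutral) (auto simp: point_mass.rep_eq split: if_splits)
  then show "l1_fun (point_mass s * point_mass t) v = l1_fun (point_mass (s * t)) v"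
    by (simp add: times_l1.rep_eq convolution_def point_mass.rep_eq)
qed

section \<open>The completed projective tensor product\<close>

text \<open>
  Every element of $A \mathbin{\hat\otimes} B$ is the sum of a series $\sum_n x_n \otimes y_n$ with
  $\sum_n \|x_n\| \|y_n\| < \infty$, its norm is the infimum of $\sum_n \|x_n\| \|y_n\|$ over all such
  series, and it is determined by its values $\sum_n \phi(x_n, y_n)$ at the bounded bilinear forms
  $\phi$, because $(A \mathbin{\hat\otimes} B)'$ is the space of these forms. This gives the concrete
  model below. That it is the completed projective tensor product is confirmed by: it is a Banach
  space, the elementary tensors span a dense subspace (\<open>represents_has_sum\<close>),
  $\|a \otimes b\| \le \|a\| \|b\|$ (\<open>norm_tensor_le\<close>), and every bounded bilinear map factors uniquely,
  with no increase of the norm (\<open>ptensor_universal\<close>, \<open>ptensor_linear_unique\<close>).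
\<close>

definition tensor_series ::
    "(nat \<Rightarrow> 'a::complex_banach) \<Rightarrow> (nat \<Rightarrow> 'b::complex_banach) \<Rightarrow> ('a \<Rightarrow> 'b \<Rightarrow> complex) \<Rightarrow> complex"
  where "tensor_series x y \<phi> = (if bounded_cbilinear \<phi> then \<Sum>\<^sub>\<infinity>n. \<phi> (x n) (y n) else 0)"

typedef (overloaded) ('a, 'b) ptensor =
    "{u. \<exists>(x :: nat \<Rightarrow> 'a::complex_banach) (y :: nat \<Rightarrow> 'b::complex_banach).
        (\<lambda>n. norm (x n) * norm (y n)) summable_on UNIV \<and> u = tensor_series x y}"
  morphisms ptensor_fun Abs_ptensor
  by (rule exI[of _ "tensor_series (\<lambda>_. 0) (\<lambda>_. 0)"]) force

setup_lifting type_definition_ptensor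

definition represents ::
    "(nat \<Rightarrow> 'a::complex_banach) \<Rightarrow> (nat \<Rightarrow> 'b::complex_banach) \<Rightarrow> ('a, 'b) ptensor \<Rightarrow> bool"
  where "represents x y u \<longleftrightarrow>
    (\<lambda>n. norm (x n) * norm (y n)) summable_on UNIV \<and> ptensor_fun u = tensor_series x y"

lemma ex_represents: "\<exists>x y. represents x y u"
  using ptensor_fun[of u] by (auto simp: represents_def)

lemma represents_unique: "represents x y u \<Longrightarrow> represents x y v \<Longrightarrow> u = v"
  by (simp add: represents_def ptensor_fun_inject[symmetric])

lemma ptensor_eqI:
  "(\<And>\<phi>. bounded_cbilinear \<phi> \<Longrightarrow> ptensor_fun u \<phi> = ptensor_fun v \<phi>) \<Longrightarrow> u = v"
  using ex_represents[of u] ex_represents[of v]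
  by (auto simp: represents_def ptensor_fun_inject[symmetric] fun_eq_iff tensor_series_def split: if_splits)

lemma bounded_cbilinear_bound:
  assumes "bounded_cbilinear B"
  obtains K where "0 \<le> K" "\<And>x y. norm (B x y) \<le> K * (norm x * norm y)"
  using assms bounded_bilinear.nonneg_bounded[of B]
  by (auto simp: bounded_cbilinear_def mult.commute mult.left_commute)

lemma bounded_cbilinear_summable:
  fixes B :: "'a::complex_banach \<Rightarrow> 'b::complex_banach \<Rightarrow> 'c::complex_banach"
  assumes B: "bounded_cbilinear B" and xy: "(\<lambda>n. norm (x n) * norm (y n)) summable_on A"
  shows "(\<lambda>n. B (x n) (y n)) abs_summable_on A"
proof -
  obtain K where K: "0 \<le> K" "\<And>x y. norm (B x y) \<le> K * (norm x * norm y)"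
    using bounded_cbilinear_bound[OF B] by metis
  show ?thesis
    by (rule summable_on_comparison_test[OF summable_on_cmult_right[OF xy, of K]]) (use K in auto)
qed

lemma tensor_series_merge:
  fixes x :: "nat \<Rightarrow> nat \<Rightarrow> 'a::complex_banach" and y :: "nat \<Rightarrow> nat \<Rightarrow> 'b::complex_banach"
  assumes row: "\<And>k. (\<lambda>n. norm (x k n) * norm (y k n)) summable_on UNIV"
    and tot: "(\<lambda>k. \<Sum>\<^sub>\<infinity>n. norm (x k n) * norm (y k n)) summable_on UNIV"
  shows "\<exists>X Y. (\<lambda>m. norm (X m) * norm (Y m)) summable_on UNIV \<and>
    (\<Sum>\<^sub>\<infinity>m. norm (X m) * norm (Y m)) = (\<Sum>\<^sub>\<infinity>k. \<Sum>\<^sub>\<infinity>n. norm (x k n) * norm (y k n)) \<and>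
    (\<forall>\<phi>. bounded_cbilinear \<phi> \<longrightarrow>
      ((\<lambda>k. tensor_series (x k) (y k) \<phi>) has_sum tensor_series X Y \<phi>) UNIV)"
proof -
  define X where "X m = (case prod_decode m of (k, n) \<Rightarrow> x k n)" for m
  define Y where "Y m = (case prod_decode m of (k, n) \<Rightarrow> y k n)" for m
  have bij: "bij_betw prod_decode UNIV (UNIV \<times> UNIV)"
    by (simp add: bij_prod_decode)
  have "(\<lambda>(k, n). norm (x k n) * norm (y k n)) abs_summable_on UNIV \<times> UNIV"
    unfolding abs_summable_on_Sigma_iff using row tot by (simp add: infsum_nonneg)
  then have joint: "(\<lambda>(k, n). norm (x k n) * norm (y k n)) summable_on UNIV \<times> UNIV"
    by (rule abs_summable_summable)
  have XY: "(\<lambda>m. norm (X m) * norm (Y m)) = (\<lambda>m. case prod_decode m of (k, n) \<Rightarrow> norm (x k n) * norm (y k n))"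
    by (auto simp: X_def Y_def split: prod.splits)
  show ?thesis
  proof (intro exI[of _ X] exI[of _ Y] conjI allI impI)
    show "(\<lambda>m. norm (X m) * norm (Y m)) summable_on UNIV"
      unfolding XY using summable_on_reindex_bij_betw[OF bij] joint by blast
    have "(\<Sum>\<^sub>\<infinity>m. norm (X m) * norm (Y m)) = (\<Sum>\<^sub>\<infinity>(k, n)\<in>UNIV \<times> UNIV. norm (x k n) * norm (y k n))"
      unfolding XY by (rule infsum_reindex_bij_betw[OF bij])
    then show "(\<Sum>\<^sub>\<infinity>m. norm (X m) * norm (Y m)) = (\<Sum>\<^sub>\<infinity>k. \<Sum>\<^sub>\<infinity>n. norm (x k n) * norm (y k n))"
      using infsum_Sigma'_banach[OF joint] by simp
  next
    fix \<phi> :: "'a \<Rightarrow> 'b \<Rightarrow> complex" assume \<phi>: "bounded_cbilinear \<phi>"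
    have "(\<lambda>p. norm (x (fst p) (snd p)) * norm (y (fst p) (snd p))) summable_on UNIV \<times> UNIV"
      using joint by (simp add: case_prod_unfold)
    from abs_summable_summable[OF bounded_cbilinear_summable[OF \<phi> this]]
    have J: "(\<lambda>(k, n). \<phi> (x k n) (y k n)) summable_on UNIV \<times> UNIV"
      by (simp add: case_prod_unfold)
    have summ: "(\<lambda>k. tensor_series (x k) (y k) \<phi>) summable_on UNIV"
      using summable_on_Sigma_banach[OF J] \<phi> by (simp add: tensor_series_def)
    have "tensor_series X Y \<phi> = (\<Sum>\<^sub>\<infinity>m. case prod_decode m of (k, n) \<Rightarrow> \<phi> (x k n) (y k n))"
      using \<phi> by (simp add: tensor_series_def X_def Y_def case_prod_unfold)
    also have "\<dots> = (\<Sum>\<^sub>\<infinity>(k, n)\<in>UNIV \<times> UNIV. \<phi> (x k n) (y k n))"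
      by (rule infsum_reindex_bij_betw[OF bij])
    also have "\<dots> = (\<Sum>\<^sub>\<infinity>k. tensor_series (x k) (y k) \<phi>)"
      using infsum_Sigma'_banach[OF J] \<phi> by (simp add: tensor_series_def)
    finally show "((\<lambda>k. tensor_series (x k) (y k) \<phi>) has_sum tensor_series X Y \<phi>) UNIV"
      using summ by (simp add: has_sum_iff)
  qed
qed

lemma tensor_series_scale:
  assumes "(\<lambda>n. norm (x n) * norm (y n)) summable_on UNIV"
  shows "(\<lambda>n. norm (c *\<^sub>C x n) * norm (y n)) summable_on UNIV"
    and "(\<Sum>\<^sub>\<infinity>n. norm (c *\<^sub>C x n) * norm (y n)) = cmod c * (\<Sum>\<^sub>\<infinity>n. norm (x n) * norm (y n))"
    and "tensor_series (\<lambda>n. c *\<^sub>C x n) y = (\<lambda>\<phi>. c * tensor_series x y \<phi>)"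
proof -
  show "(\<lambda>n. norm (c *\<^sub>C x n) * norm (y n)) summable_on UNIV"
    unfolding norm_scaleC mult.assoc using assms by (rule summable_on_cmult_right)
  show "(\<Sum>\<^sub>\<infinity>n. norm (c *\<^sub>C x n) * norm (y n)) = cmod c * (\<Sum>\<^sub>\<infinity>n. norm (x n) * norm (y n))"
    unfolding norm_scaleC mult.assoc by (rule infsum_cmult_right')
  have "tensor_series (\<lambda>n. c *\<^sub>C x n) y \<phi> = c * tensor_series x y \<phi>" for \<phi>
  proof (cases "bounded_cbilinear \<phi>")
    case True
    then have "\<phi> (c *\<^sub>C a) b = c * \<phi> a b" for a b
      by (simp add: bounded_cbilinear_def scaleC_complex_def)
    with True show ?thesis
      by (simp add: tensor_series_def infsum_cmult_right')
  qed (simp add: tensor_series_def)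
  then show "tensor_series (\<lambda>n. c *\<^sub>C x n) y = (\<lambda>\<phi>. c * tensor_series x y \<phi>)" by auto
qed

lemma tensor_series_add:
  assumes "(\<lambda>n. norm (x n) * norm (y n)) summable_on UNIV" "(\<lambda>n. norm (x' n) * norm (y' n)) summable_on UNIV"
  shows "\<exists>X Y. (\<lambda>n. norm (X n) * norm (Y n)) summable_on UNIV \<and>
    (\<Sum>\<^sub>\<infinity>n. norm (X n) * norm (Y n)) =
      (\<Sum>\<^sub>\<infinity>n. norm (x n) * norm (y n)) + (\<Sum>\<^sub>\<infinity>n. norm (x' n) * norm (y' n)) \<and>
    (\<lambda>\<phi>. tensor_series x y \<phi> + tensor_series x' y' \<phi>) = tensor_series X Y"
proof -
  define u where "u k = (if k = 0 then x else if k = (1::nat) then x' else (\<lambda>_. 0))" for k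
  define v where "v k = (if k = 0 then y else if k = (1::nat) then y' else (\<lambda>_. 0))" for k
  have two: "f summable_on UNIV \<and> infsum f UNIV = f 0 + f 1" if "\<And>k. k \<ge> 2 \<Longrightarrow> f k = 0"
    for f :: "nat \<Rightarrow> 'z::{comm_monoid_add, t2_space}"
  proof -
    have "(f has_sum (f 0 + f 1)) {0, 1}"
      by (rule has_sum_finiteI) auto
    then have "(f has_sum (f 0 + f 1)) UNIV"
      by (subst (asm) has_sum_cong_neutral[where T = UNIV and g = f]) (use that in \<open>auto simp: not_less_eq_eq\<close>)
    then show ?thesis
      by (auto intro: has_sum_imp_summable infsumI)
  qed
  have row: "(\<lambda>n. norm (u k n) * norm (v k n)) summable_on UNIV" for k
    using assms by (auto simp: u_def v_def)
  have tot: "(\<lambda>k. \<Sum>\<^sub>\<infinity>n. norm (u k n) * norm (v k n)) summable_on UNIV"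
    and tot_eq: "(\<Sum>\<^sub>\<infinity>k. \<Sum>\<^sub>\<infinity>n. norm (u k n) * norm (v k n)) =
      (\<Sum>\<^sub>\<infinity>n. norm (x n) * norm (y n)) + (\<Sum>\<^sub>\<infinity>n. norm (x' n) * norm (y' n))"
    using two[of "\<lambda>k. \<Sum>\<^sub>\<infinity>n. norm (u k n) * norm (v k n)"] by (auto simp: u_def v_def)
  have z: "k \<ge> 2 \<Longrightarrow> tensor_series (u k) (v k) \<phi> = 0" for k \<phi>
    by (auto simp: u_def v_def tensor_series_def bounded_cbilinear_def bounded_bilinear.zero_left)
  obtain X Y where XY: "(\<lambda>m. norm (X m) * norm (Y m)) summable_on UNIV"
    "(\<Sum>\<^sub>\<infinity>m. norm (X m) * norm (Y m)) = (\<Sum>\<^sub>\<infinity>k. \<Sum>\<^sub>\<infinity>n. norm (u k n) * norm (v k n))"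
    "\<forall>\<phi>. bounded_cbilinear \<phi> \<longrightarrow> ((\<lambda>k. tensor_series (u k) (v k) \<phi>) has_sum tensor_series X Y \<phi>) UNIV"
    using tensor_series_merge[OF row tot] by blast
  show ?thesis
  proof (intro exI[of _ X] exI[of _ Y] conjI XY(1))
    show "(\<Sum>\<^sub>\<infinity>n. norm (X n) * norm (Y n)) =
      (\<Sum>\<^sub>\<infinity>n. norm (x n) * norm (y n)) + (\<Sum>\<^sub>\<infinity>n. norm (x' n) * norm (y' n))"
      using XY(2) tot_eq by simp
    have "tensor_series X Y \<phi> = tensor_series x y \<phi> + tensor_series x' y' \<phi>" for \<phi>
    proof (cases "bounded_cbilinear \<phi>")
      case True
      then show ?thesis
        using infsumI[OF XY(3)[rule_format, OF True]] two[of "\<lambda>k. tensor_series (u k) (v k) \<phi>"] z by (simp add: u_def v_def)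
    qed (simp add: tensor_series_def)
    then show "(\<lambda>\<phi>. tensor_series x y \<phi> + tensor_series x' y' \<phi>) = tensor_series X Y" by auto
  qed
qed

lemma tensor_series_add_closed:
  assumes "\<exists>x y. (\<lambda>n. norm (x n) * norm (y n)) summable_on UNIV \<and> u = tensor_series x y"
    and "\<exists>x y. (\<lambda>n. norm (x n) * norm (y n)) summable_on UNIV \<and> v = tensor_series x y"
  shows "\<exists>x y. (\<lambda>n. norm (x n) * norm (y n)) summable_on UNIV \<and> (\<lambda>\<phi>. u \<phi> + v \<phi>) = tensor_series x y"
proof -
  obtain x y where u: "(\<lambda>n. norm (x n) * norm (y n)) summable_on UNIV" "u = tensor_series x y"
    using assms(1) by blast
  obtain x' y' where v: "(\<lambda>n. norm (x' n) * norm (y' n)) summable_on UNIV" "v = tensor_series x' y'"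
    using assms(2) by blast
  obtain X Y where XY: "(\<lambda>n. norm (X n) * norm (Y n)) summable_on UNIV"
    "(\<lambda>\<phi>. tensor_series x y \<phi> + tensor_series x' y' \<phi>) = tensor_series X Y"
    by (rule exE[OF tensor_series_add[OF u(1) v(1)]], elim exE conjE) (rule that)
  have "(\<lambda>\<phi>. u \<phi> + v \<phi>) = tensor_series X Y"
    unfolding u(2) v(2) by (rule XY(2))
  with XY(1) have "(\<lambda>n. norm (X n) * norm (Y n)) summable_on UNIV \<and> (\<lambda>\<phi>. u \<phi> + v \<phi>) = tensor_series X Y"
    by (rule conjI)
  then have "\<exists>y. (\<lambda>n. norm (X n) * norm (y n)) summable_on UNIV \<and> (\<lambda>\<phi>. u \<phi> + v \<phi>) = tensor_series X y"
    by (rule exI[of _ Y])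
  then show ?thesis
    by (rule exI[of _ X])
qed

lemma tensor_series_scale_closed:
  assumes "\<exists>x y. (\<lambda>n. norm (x n) * norm (y n)) summable_on UNIV \<and> u = tensor_series x y"
  shows "\<exists>x y. (\<lambda>n. norm (x n) * norm (y n)) summable_on UNIV \<and> (\<lambda>\<phi>. c * u \<phi>) = tensor_series x y"
proof -
  obtain x y where u: "(\<lambda>n. norm (x n) * norm (y n)) summable_on UNIV" "u = tensor_series x y"
    using assms by blast
  have "(\<lambda>\<phi>. c * u \<phi>) = tensor_series (\<lambda>n. c *\<^sub>C x n) y"
    unfolding u(2) by (rule tensor_series_scale(3)[OF u(1), symmetric])
  with tensor_series_scale(1)[OF u(1)]
  have "(\<lambda>n. norm (c *\<^sub>C x n) * norm (y n)) summable_on UNIV \<and>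
      (\<lambda>\<phi>. c * u \<phi>) = tensor_series (\<lambda>n. c *\<^sub>C x n) y"
    by (rule conjI)
  then have "\<exists>y. (\<lambda>n. norm (c *\<^sub>C x n) * norm (y n)) summable_on UNIV \<and>
      (\<lambda>\<phi>. c * u \<phi>) = tensor_series (\<lambda>n. c *\<^sub>C x n) y"
    by (rule exI[of _ y])
  then show ?thesis
    by (rule exI[of _ "\<lambda>n. c *\<^sub>C x n"])
qed

instantiation ptensor :: (complex_banach, complex_banach) complex_normed_vector
begin

lift_definition zero_ptensor :: "('a, 'b) ptensor" is "\<lambda>_. 0"
  by (rule exI[of _ "\<lambda>_. 0"], rule exI[of _ "\<lambda>_. 0"])
    (auto simp: tensor_series_def fun_eq_iff bounded_cbilinear_def bounded_bilinear.zero_left)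

lift_definition plus_ptensor :: "('a, 'b) ptensor \<Rightarrow> ('a, 'b) ptensor \<Rightarrow> ('a, 'b) ptensor"
  is "\<lambda>u v \<phi>. u \<phi> + v \<phi>"
  by (rule tensor_series_add_closed)

lift_definition scaleC_ptensor :: "complex \<Rightarrow> ('a, 'b) ptensor \<Rightarrow> ('a, 'b) ptensor"
  is "\<lambda>c u \<phi>. c * u \<phi>"
  by (rule tensor_series_scale_closed)

definition uminus_ptensor :: "('a, 'b) ptensor \<Rightarrow> ('a, 'b) ptensor"
  where "uminus_ptensor u = (- 1) *\<^sub>C u"

definition minus_ptensor :: "('a, 'b) ptensor \<Rightarrow> ('a, 'b) ptensor \<Rightarrow> ('a, 'b) ptensor"
  where "minus_ptensor u v = u + (- 1) *\<^sub>C v"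

definition scaleR_ptensor :: "real \<Rightarrow> ('a, 'b) ptensor \<Rightarrow> ('a, 'b) ptensor"
  where "scaleR_ptensor r u = complex_of_real r *\<^sub>C u"

definition norm_ptensor :: "('a, 'b) ptensor \<Rightarrow> real"
  where "norm_ptensor u = Inf {\<Sum>\<^sub>\<infinity>n. norm (x n) * norm (y n) | x y. represents x y u}"

definition sgn_ptensor :: "('a, 'b) ptensor \<Rightarrow> ('a, 'b) ptensor"
  where "sgn_ptensor u = inverse (norm u) *\<^sub>R u"

definition dist_ptensor :: "('a, 'b) ptensor \<Rightarrow> ('a, 'b) ptensor \<Rightarrow> real"
  where "dist_ptensor u v = norm (u - v)"

definition uniformity_ptensor :: "(('a, 'b) ptensor \<times> ('a, 'b) ptensor) filter"
  where "uniformity_ptensor = (INF e\<in>{0<..}. principal {(u, v). dist u v < e})"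

definition open_ptensor :: "('a, 'b) ptensor set \<Rightarrow> bool"
  where "open_ptensor U = (\<forall>u\<in>U. \<forall>\<^sub>F (v, w) in uniformity. v = u \<longrightarrow> w \<in> U)"

lemma norm_ptensor_le:
  assumes "represents x y (u :: ('a, 'b) ptensor)"
  shows "norm u \<le> (\<Sum>\<^sub>\<infinity>n. norm (x n) * norm (y n))"
  unfolding norm_ptensor_def using assms
  by (intro cInf_lower bdd_belowI[of _ 0]) (auto simp: infsum_nonneg)

lemma norm_ptensor_greatest:
  assumes "\<And>x y. represents x y (u :: ('a, 'b) ptensor) \<Longrightarrow> c \<le> (\<Sum>\<^sub>\<infinity>n. norm (x n) * norm (y n))"
  shows "c \<le> norm u"
  unfolding norm_ptensor_def using assms ex_represents[of u]
  by (intro cInf_greatest) auto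

lemma norm_ptensor_approx:
  assumes "norm (u :: ('a, 'b) ptensor) < c"
  obtains x y where "represents x y u" "(\<Sum>\<^sub>\<infinity>n. norm (x n) * norm (y n)) < c"
  using norm_ptensor_greatest[of u c] assms by force

lemma ptensor_fun_bound:
  assumes K: "\<And>x y. norm (\<phi> x y) \<le> K * (norm x * norm y)" "0 \<le> K" and \<phi>: "bounded_cbilinear \<phi>"
  shows "cmod (ptensor_fun (u :: ('a, 'b) ptensor) \<phi>) \<le> K * norm u"
proof (cases "K = 0")
  case True
  then have "\<phi> x y = 0" for x y using K(1)[of x y] by simp
  then show ?thesis
    using ex_represents[of u] True by (auto simp: represents_def tensor_series_def)
next
  case False
  then have K0: "K > 0" using K by simp
  have "cmod (ptensor_fun u \<phi>) / K \<le> norm u"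
  proof (rule norm_ptensor_greatest)
    fix x y assume xy: "represents x y u"
    then have s: "(\<lambda>n. norm (x n) * norm (y n)) summable_on UNIV" by (simp add: represents_def)
    have "cmod (ptensor_fun u \<phi>) = cmod (\<Sum>\<^sub>\<infinity>n. \<phi> (x n) (y n))"
      using xy \<phi> by (simp add: represents_def tensor_series_def)
    also have "\<dots> \<le> (\<Sum>\<^sub>\<infinity>n. K * (norm (x n) * norm (y n)))"
      by (rule norm_infsum_le[OF has_sum_infsum has_sum_infsum])
        (use K s abs_summable_summable[OF bounded_cbilinear_summable[OF \<phi> s]] in \<open>auto intro: summable_on_cmult_right\<close>)
    also have "\<dots> = K * (\<Sum>\<^sub>\<infinity>n. norm (x n) * norm (y n))"
      by (rule infsum_cmult_right')
    finally show "cmod (ptensor_fun u \<phi>) / K \<le> (\<Sum>\<^sub>\<infinity>n. norm (x n) * norm (y n))"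
      using K0 by (simp add: field_simps)
  qed
  then show ?thesis using K0 by (simp add: field_simps)
qed

instance
proof
  fix u v w :: "('a, 'b) ptensor" and a b :: complex and r q :: real
  show "u + v + w = u + (v + w)" "u + v = v + u" "0 + u = u"
    and C: "a *\<^sub>C (u + v) = a *\<^sub>C u + a *\<^sub>C v" "(a + b) *\<^sub>C u = a *\<^sub>C u + b *\<^sub>C u"
    "a *\<^sub>C b *\<^sub>C u = (a * b) *\<^sub>C u" for a b
    by (transfer; simp add: algebra_simps)+
  show "- u + u = 0" "u - v = u + - v" "complex_of_real r *\<^sub>C u = r *\<^sub>R u"
    unfolding uminus_ptensor_def minus_ptensor_def scaleR_ptensor_def by (transfer; simp)+
  show "r *\<^sub>R (u + v) = r *\<^sub>R u + r *\<^sub>R v" "(r + q) *\<^sub>R u = r *\<^sub>R u + q *\<^sub>R u"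
    "r *\<^sub>R q *\<^sub>R u = (r * q) *\<^sub>R u"
    by (simp_all add: scaleR_ptensor_def C)
  show "1 *\<^sub>R u = u"
    unfolding scaleR_ptensor_def by transfer simp
  have scale_le: "norm (c *\<^sub>C u) \<le> cmod c * norm u" for c and u :: "('a, 'b) ptensor"
  proof (rule field_le_epsilon)
    fix e :: real assume e: "0 < e"
    define d where "d = e / (cmod c + 1)"
    have d: "0 < d" "cmod c * d \<le> e"
      using e by (auto simp: d_def field_simps add_pos_nonneg)
    obtain x y where xy: "represents x y u" "(\<Sum>\<^sub>\<infinity>n. norm (x n) * norm (y n)) < norm u + d"
      using norm_ptensor_approx[of u "norm u + d"] d by auto
    have "represents (\<lambda>n. c *\<^sub>C x n) y (c *\<^sub>C u)"
      using xy(1) tensor_series_scale[of x y c] by (simp add: represents_def scaleC_ptensor.rep_eq)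
    from norm_ptensor_le[OF this] have "norm (c *\<^sub>C u) \<le> cmod c * (\<Sum>\<^sub>\<infinity>n. norm (x n) * norm (y n))"
      using xy(1) tensor_series_scale[of x y c] by (simp add: represents_def)
    also have "\<dots> \<le> cmod c * (norm u + d)"
      using xy(2) by (intro mult_left_mono) auto
    finally show "norm (c *\<^sub>C u) \<le> cmod c * norm u + e"
      using d(2) by (simp add: algebra_simps)
  qed
  have norm0: "norm (0 :: ('a, 'b) ptensor) = 0"
  proof (rule antisym)
    have "represents (\<lambda>_. 0) (\<lambda>_. 0) (0 :: ('a, 'b) ptensor)"
      by (auto simp: represents_def zero_ptensor.rep_eq tensor_series_def fun_eq_iff
          bounded_cbilinear_def bounded_bilinear.zero_left)
    from norm_ptensor_le[OF this] show "norm (0 :: ('a, 'b) ptensor) \<le> 0" by simp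
    show "0 \<le> norm (0 :: ('a, 'b) ptensor)"
      by (rule norm_ptensor_greatest) (simp add: infsum_nonneg)
  qed
  show scaleC: "norm (c *\<^sub>C u) = cmod c * norm u" for c and u :: "('a, 'b) ptensor"
  proof (cases "c = 0")
    case True
    have "(0::complex) *\<^sub>C u = 0" by transfer simp
    with True norm0 show ?thesis by simp
  next
    case False
    have "norm (inverse c *\<^sub>C c *\<^sub>C u) \<le> cmod (inverse c) * norm (c *\<^sub>C u)"
      by (rule scale_le)
    also have "inverse c *\<^sub>C c *\<^sub>C u = u"
      using False by transfer (simp flip: mult.assoc)
    finally show ?thesis
      using scale_le[of c u] False by (simp add: norm_divide field_simps)
  qed
  then show "norm (r *\<^sub>R u) = \<bar>r\<bar> * norm u"
    by (simp add: scaleR_ptensor_def)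
  show "norm u = 0 \<longleftrightarrow> u = 0"
  proof
    assume 0: "norm u = 0"
    show "u = 0"
    proof (rule ptensor_eqI)
      fix \<phi> :: "'a \<Rightarrow> 'b \<Rightarrow> complex" assume \<phi>: "bounded_cbilinear \<phi>"
      obtain K where "0 \<le> K" "\<And>x y. norm (\<phi> x y) \<le> K * (norm x * norm y)"
        using bounded_cbilinear_bound[OF \<phi>] by metis
      with ptensor_fun_bound[of \<phi> K u] \<phi> 0 show "ptensor_fun u \<phi> = ptensor_fun 0 \<phi>"
        by (simp add: zero_ptensor.rep_eq)
    qed
  qed (simp add: norm0)
  show "norm (u + v) \<le> norm u + norm v"
  proof (rule field_le_epsilon)
    fix e :: real assume e: "0 < e"
    obtain x y where xy: "represents x y u" "(\<Sum>\<^sub>\<infinity>n. norm (x n) * norm (y n)) < norm u + e / 2"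
      using norm_ptensor_approx[of u "norm u + e / 2"] e by auto
    obtain x' y' where xy': "represents x' y' v" "(\<Sum>\<^sub>\<infinity>n. norm (x' n) * norm (y' n)) < norm v + e / 2"
      using norm_ptensor_approx[of v "norm v + e / 2"] e by auto
    obtain X Y where XY: "(\<lambda>n. norm (X n) * norm (Y n)) summable_on UNIV"
      "(\<Sum>\<^sub>\<infinity>n. norm (X n) * norm (Y n)) =
        (\<Sum>\<^sub>\<infinity>n. norm (x n) * norm (y n)) + (\<Sum>\<^sub>\<infinity>n. norm (x' n) * norm (y' n))"
      "(\<lambda>\<phi>. tensor_series x y \<phi> + tensor_series x' y' \<phi>) = tensor_series X Y"
      using tensor_series_add[of x y x' y'] xy(1) xy'(1) unfolding represents_def by blast
    have "represents X Y (u + v)"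
      using XY xy(1) xy'(1) by (simp add: represents_def plus_ptensor.rep_eq)
    from norm_ptensor_le[OF this] show "norm (u + v) \<le> norm u + norm v + e"
      using XY(2) xy(2) xy'(2) by simp
  qed
qed (simp_all add: sgn_ptensor_def dist_ptensor_def uniformity_ptensor_def open_ptensor_def)

end

lemma ptensor_fun_diff: "ptensor_fun (u - v) \<phi> = ptensor_fun u \<phi> - ptensor_fun v \<phi>"
  by (simp add: minus_ptensor_def plus_ptensor.rep_eq scaleC_ptensor.rep_eq)

lemma ptensor_fun_sum: "ptensor_fun (sum u A) \<phi> = (\<Sum>k\<in>A. ptensor_fun (u k) \<phi>)"
  by (induction A rule: infinite_finite_induct) (simp_all add: zero_ptensor.rep_eq plus_ptensor.rep_eq)

lemma ptensor_absolutely_convergent: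
  fixes u :: "nat \<Rightarrow> ('a::complex_banach, 'b::complex_banach) ptensor"
  assumes u: "summable (\<lambda>n. norm (u n))"
  shows "summable u"
proof -
  have "\<exists>x y. represents x y (u k) \<and> (\<Sum>\<^sub>\<infinity>n. norm (x n) * norm (y n)) < norm (u k) + (1/2) ^ k" for k
  proof -
    have "norm (u k) < norm (u k) + (1/2) ^ k" by simp
    from norm_ptensor_approx[OF this] show ?thesis by blast
  qed
  then obtain x y where xy: "\<And>k. represents (x k) (y k) (u k)"
    and le: "\<And>k. (\<Sum>\<^sub>\<infinity>n. norm (x k n) * norm (y k n)) < norm (u k) + (1/2) ^ k"
    by metis
  define s where "s k = (\<Sum>\<^sub>\<infinity>n. norm (x k n) * norm (y k n))" for k
  have s0: "0 \<le> s k" for k by (simp add: s_def infsum_nonneg)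
  have row: "(\<lambda>n. norm (x k n) * norm (y k n)) summable_on UNIV" for k
    using xy by (simp add: represents_def)
  have s: "summable s"
    by (rule summable_comparison_test[OF _ summable_add[OF u summable_geometric[of "1/2::real"]]])
      (use le s0 in \<open>auto simp: s_def[symmetric] intro!: exI[of _ 0] less_imp_le\<close>)
  have shift: "(\<lambda>k. s (k + n)) summable_on UNIV" "(\<Sum>\<^sub>\<infinity>k. s (k + n)) = (\<Sum>k. s (k + n))" for n
  proof -
    have "summable (\<lambda>k. s (k + n))" using s by (simp add: summable_iff_shift)
    then show *: "(\<lambda>k. s (k + n)) summable_on UNIV"
      using s0 by (intro norm_summable_imp_summable_on) simp
    show "(\<Sum>\<^sub>\<infinity>k. s (k + n)) = (\<Sum>k. s (k + n))"
      using has_sum_imp_sums[OF has_sum_infsum[OF *]] by (simp add: sums_iff)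
  qed
  have tails: "\<exists>v. norm v \<le> (\<Sum>k. s (k + n)) \<and>
      (\<forall>\<phi>. bounded_cbilinear \<phi> \<longrightarrow> (\<lambda>k. ptensor_fun (u (k + n)) \<phi>) sums ptensor_fun v \<phi>)" for n
  proof -
    obtain X Y where XY: "(\<lambda>m. norm (X m) * norm (Y m)) summable_on UNIV"
      "(\<Sum>\<^sub>\<infinity>m. norm (X m) * norm (Y m)) = (\<Sum>\<^sub>\<infinity>k. s (k + n))"
      "\<forall>\<phi>. bounded_cbilinear \<phi> \<longrightarrow>
        ((\<lambda>k. tensor_series (x (k + n)) (y (k + n)) \<phi>) has_sum tensor_series X Y \<phi>) UNIV"
      using tensor_series_merge[of "\<lambda>k. x (k + n)" "\<lambda>k. y (k + n)",
          OF row shift(1)[of n, unfolded s_def]] unfolding s_def by blast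
    define v where "v = Abs_ptensor (tensor_series X Y)"
    have v: "represents X Y v"
      using XY(1) unfolding v_def represents_def by (subst Abs_ptensor_inverse) auto
    have "(\<lambda>k. ptensor_fun (u (k + n)) \<phi>) sums ptensor_fun v \<phi>" if "bounded_cbilinear \<phi>" for \<phi>
      using has_sum_imp_sums[OF XY(3)[rule_format, OF that]] v xy
      by (simp add: represents_def)
    then show ?thesis
      using norm_ptensor_le[OF v] XY(2) shift(2)[of n] by (intro exI[of _ v]) auto
  qed
  then obtain v where v: "\<And>n. norm (v n) \<le> (\<Sum>k. s (k + n))"
    "\<And>n \<phi>. bounded_cbilinear \<phi> \<Longrightarrow> (\<lambda>k. ptensor_fun (u (k + n)) \<phi>) sums ptensor_fun (v n) \<phi>"
    by metis
  have v_eq: "v n = v 0 - (\<Sum>k<n. u k)" for n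
  proof (rule ptensor_eqI)
    fix \<phi> :: "'a \<Rightarrow> 'b \<Rightarrow> complex" assume \<phi>: "bounded_cbilinear \<phi>"
    have "(\<lambda>k. ptensor_fun (u k) \<phi>) sums ptensor_fun (v 0) \<phi>"
      using v(2)[OF \<phi>, of 0] by simp
    then have "(\<lambda>k. ptensor_fun (u (k + n)) \<phi>) sums (ptensor_fun (v 0) \<phi> - (\<Sum>k<n. ptensor_fun (u k) \<phi>))"
      by (rule sums_split_initial_segment)
    then show "ptensor_fun (v n) \<phi> = ptensor_fun (v 0 - (\<Sum>k<n. u k)) \<phi>"
      using v(2)[OF \<phi>, of n] by (simp add: ptensor_fun_diff ptensor_fun_sum sums_unique2)
  qed
  have "(\<lambda>n. norm (v n)) \<longlonglongrightarrow> 0"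
    by (rule tendsto_sandwich[OF _ _ tendsto_const suminf_tail_tendsto_0[OF s]]) (use v(1) in auto)
  then have "v \<longlonglongrightarrow> 0" by (rule tendsto_norm_zero_cancel)
  then have "(\<lambda>n. v 0 - v n) \<longlonglongrightarrow> v 0 - 0"
    by (intro tendsto_diff tendsto_const)
  moreover have "(\<Sum>k<n. u k) = v 0 - v n" for n
    using v_eq[of n] by simp
  ultimately show ?thesis
    by (auto simp: summable_iff_convergent convergent_def)
qed

instance ptensor :: (complex_banach, complex_banach) complex_banach
  by standard (rule Cauchy_convergent_if_norm_summable[OF ptensor_absolutely_convergent])

lift_definition tensor :: "'a::complex_banach \<Rightarrow> 'b::complex_banach \<Rightarrow> ('a, 'b) ptensor"  (infixr "\<otimes>" 70)
  is "\<lambda>a b. tensor_series (\<lambda>n. if n = 0 then a else 0) (\<lambda>n. b)"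
  subgoal for a b
    by (rule exI, rule exI, rule conjI[OF _ refl],
        subst summable_on_cong_neutral[where T = "{0}" and g = "\<lambda>_. norm a * norm b"]) auto
  done

lemma infsum_nat_single:
  "(\<And>n. n > 0 \<Longrightarrow> f n = 0) \<Longrightarrow> infsum f (UNIV :: nat set) = f 0"
  for f :: "nat \<Rightarrow> 'z::{comm_monoid_add, t2_space}"
  by (subst infsum_cong_neutral[where T = "{0}" and g = f]) auto

lemma ptensor_fun_tensor: "ptensor_fun (a \<otimes> b) \<phi> = (if bounded_cbilinear \<phi> then \<phi> a b else 0)"
  by (auto simp: tensor.rep_eq tensor_series_def bounded_cbilinear_def bounded_bilinear.zero_left
      intro!: trans[OF infsum_nat_single])

lemma norm_tensor_le: "norm (a \<otimes> b) \<le> norm a * norm b"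
proof -
  have "represents (\<lambda>n. if n = 0 then a else 0) (\<lambda>n. b) (a \<otimes> b)"
    unfolding represents_def tensor.rep_eq
    by (subst summable_on_cong_neutral[where T = "{0}" and g = "\<lambda>_. norm a * norm b"]) auto
  from norm_ptensor_le[OF this] show ?thesis
    by (subst (asm) infsum_nat_single) auto
qed

lemma bounded_cbilinear_tensor: "bounded_cbilinear (\<otimes>)"
proof -
  have add: "(a + a') \<otimes> b = a \<otimes> b + a' \<otimes> b" "a \<otimes> (b + b') = a \<otimes> b + a \<otimes> b'"
    and scale: "(c *\<^sub>C a) \<otimes> b = c *\<^sub>C (a \<otimes> b)" "a \<otimes> (c *\<^sub>C b) = c *\<^sub>C (a \<otimes> b)"
    for a a' :: 'a and b b' :: 'b and c
    by (rule ptensor_eqI; simp add: ptensor_fun_tensor plus_ptensor.rep_eq scaleC_ptensor.rep_eq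
        bounded_cbilinear_def bounded_bilinear.add_left bounded_bilinear.add_right scaleC_complex_def)+
  have "bounded_bilinear ((\<otimes>) :: 'a \<Rightarrow> 'b \<Rightarrow> _)"
  proof
    show "(r *\<^sub>R a) \<otimes> b = r *\<^sub>R (a \<otimes> b)" "a \<otimes> (r *\<^sub>R b) = r *\<^sub>R (a \<otimes> b)" for r and a :: 'a and b :: 'b
      using scale[where c = "complex_of_real r"] by (simp_all add: scaleC_of_real)
    show "\<exists>K. \<forall>(a :: 'a) (b :: 'b). norm (a \<otimes> b) \<le> norm a * norm b * K"
      using norm_tensor_le by (intro exI[of _ 1]) auto
  qed (use add in auto)
  with scale show ?thesis by (simp add: bounded_cbilinear_def)
qed

lemma represents_has_sum:
  assumes "represents x y u"
  shows "((\<lambda>n. x n \<otimes> y n) has_sum u) UNIV"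
proof -
  have xy: "(\<lambda>n. norm (x n) * norm (y n)) summable_on UNIV"
    using assms by (simp add: represents_def)
  have abs: "(\<lambda>n. x n \<otimes> y n) abs_summable_on UNIV"
    by (rule bounded_cbilinear_summable[OF bounded_cbilinear_tensor xy])
  have sum: "((\<lambda>n. x n \<otimes> y n) has_sum (\<Sum>\<^sub>\<infinity>n. x n \<otimes> y n)) UNIV"
    by (rule has_sum_infsum[OF abs_summable_summable[OF abs]])
  have "u = (\<Sum>\<^sub>\<infinity>n. x n \<otimes> y n)"
  proof (rule ptensor_eqI)
    fix \<phi> :: "'a \<Rightarrow> 'b \<Rightarrow> complex" assume \<phi>: "bounded_cbilinear \<phi>"
    obtain K where K: "0 \<le> K" "\<And>x y. norm (\<phi> x y) \<le> K * (norm x * norm y)"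
      using bounded_cbilinear_bound[OF \<phi>] by metis
    have "bounded_linear (\<lambda>v. ptensor_fun v \<phi>)"
    proof (rule bounded_linear_intro)
      show "cmod (ptensor_fun v \<phi>) \<le> norm v * K" for v :: "('a, 'b) ptensor"
        using ptensor_fun_bound[OF K(2,1) \<phi>, of v] by (simp add: mult.commute)
    qed (simp_all add: plus_ptensor.rep_eq scaleR_ptensor_def scaleC_ptensor.rep_eq scaleR_conv_of_real)
    from has_sum_bounded_linear[OF this sum]
    have "((\<lambda>n. \<phi> (x n) (y n)) has_sum ptensor_fun (\<Sum>\<^sub>\<infinity>n. x n \<otimes> y n) \<phi>) UNIV"
      using \<phi> by (simp add: ptensor_fun_tensor)
    then show "ptensor_fun u \<phi> = ptensor_fun (\<Sum>\<^sub>\<infinity>n. x n \<otimes> y n) \<phi>"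
      using assms \<phi> by (simp add: represents_def tensor_series_def infsumI)
  qed
  with sum show ?thesis by simp
qed

lemma ptensor_linear_unique:
  fixes f g :: "('a::complex_banach, 'b::complex_banach) ptensor \<Rightarrow> 'c::complex_banach"
  assumes f: "bounded_clinear f" and g: "bounded_clinear g"
    and eq: "\<And>a b. f (a \<otimes> b) = g (a \<otimes> b)"
  shows "f = g"
proof
  fix u :: "('a, 'b) ptensor"
  obtain x y where "represents x y u" using ex_represents by blast
  note s = represents_has_sum[OF this]
  have "((\<lambda>n. f (x n \<otimes> y n)) has_sum f u) UNIV" "((\<lambda>n. g (x n \<otimes> y n)) has_sum g u) UNIV"
    using f g by (auto intro: has_sum_bounded_linear[OF _ s] simp: bounded_clinear_def)
  then show "f u = g u"
    using eq by (metis (no_types, lifting) has_sum_cong has_sum_unique)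
qed

proposition ptensor_universal:
  fixes B :: "'a::complex_banach \<Rightarrow> 'b::complex_banach \<Rightarrow> 'c::complex_banach"
  assumes B: "bounded_cbilinear B"
  obtains f where "bounded_clinear f" "\<And>a b. f (a \<otimes> b) = B a b"
    "\<And>K u. 0 \<le> K \<Longrightarrow> (\<And>a b. norm (B a b) \<le> K * (norm a * norm b)) \<Longrightarrow> norm (f u) \<le> K * norm u"
proof -
  have comp: "bounded_cbilinear (\<lambda>a b. h (B a b))" if "bounded_clinear h" for h :: "'c \<Rightarrow> complex"
    by (rule bounded_clinear_compose_bilinear[OF that B])
  have point: "z = w" if *: "\<And>h :: 'c \<Rightarrow> complex. bounded_clinear h \<Longrightarrow> h z = h w" for z w :: 'c
  proof (rule ccontr)
    assume "z \<noteq> w"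
    then obtain h :: "'c \<Rightarrow> complex" where h: "bounded_clinear h" "h (z - w) \<noteq> 0"
      using separating_functional[of "z - w"] by auto
    then show False
      using *[OF h(1)] by (simp add: bounded_clinear_diff)
  qed
  have sum: "h (\<Sum>\<^sub>\<infinity>n. B (x n) (y n)) = ptensor_fun u (\<lambda>a b. h (B a b))"
    if "represents x y u" "bounded_clinear h" for x y u and h :: "'c \<Rightarrow> complex"
  proof -
    have "(\<lambda>n. B (x n) (y n)) summable_on UNIV"
      using that(1) by (intro abs_summable_summable[OF bounded_cbilinear_summable[OF B]]) (simp add: represents_def)
    from has_sum_bounded_linear[OF _ has_sum_infsum[OF this], of h] that comp show ?thesis
      by (auto simp: bounded_clinear_def represents_def tensor_series_def infsumI)
  qed
  define L where "L u = (SOME z. \<forall>h. bounded_clinear h \<longrightarrow> h z = ptensor_fun u (\<lambda>a b. h (B a b)))" for u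
  have L: "h (L u) = ptensor_fun u (\<lambda>a b. h (B a b))" if "bounded_clinear h" for h :: "'c \<Rightarrow> complex" and u
  proof -
    obtain x y where "represents x y u" using ex_represents by blast
    from sum[OF this] have "\<exists>z. \<forall>h. bounded_clinear h \<longrightarrow> h z = ptensor_fun u (\<lambda>a b. h (B a b))" by blast
    from someI_ex[OF this] that show ?thesis unfolding L_def by blast
  qed
  have L_sum: "L u = (\<Sum>\<^sub>\<infinity>n. B (x n) (y n))" if "represents x y u" for x y u
    by (rule point) (simp add: L sum[OF that])
  have L_tensor: "L (a \<otimes> b) = B a b" for a b
    by (rule point) (simp add: L ptensor_fun_tensor comp)
  have L_bound: "norm (L u) \<le> K * norm u" if K: "0 \<le> K" "\<And>a b. norm (B a b) \<le> K * (norm a * norm b)" for K u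
  proof (rule field_le_epsilon)
    fix e :: real assume e: "0 < e"
    define d where "d = e / (K + 1)"
    have d: "0 < d" "K * d \<le> e"
      using e K by (auto simp: d_def field_simps add_pos_nonneg)
    obtain x y where xy: "represents x y u" "(\<Sum>\<^sub>\<infinity>n. norm (x n) * norm (y n)) < norm u + d"
      using norm_ptensor_approx[of u "norm u + d"] d by auto
    then have s: "(\<lambda>n. norm (x n) * norm (y n)) summable_on UNIV" by (simp add: represents_def)
    have "norm (L u) = norm (\<Sum>\<^sub>\<infinity>n. B (x n) (y n))" using L_sum[OF xy(1)] by simp
    also have "\<dots> \<le> (\<Sum>\<^sub>\<infinity>n. K * (norm (x n) * norm (y n)))"
      by (rule norm_infsum_le[OF has_sum_infsum has_sum_infsum])
        (use K s abs_summable_summable[OF bounded_cbilinear_summable[OF B s]] in \<open>auto intro: summable_on_cmult_right\<close>)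
    also have "\<dots> = K * (\<Sum>\<^sub>\<infinity>n. norm (x n) * norm (y n))"
      by (rule infsum_cmult_right')
    also have "\<dots> \<le> K * (norm u + d)"
      using xy(2) K by (intro mult_left_mono) auto
    finally show "norm (L u) \<le> K * norm u + e"
      using d(2) by (simp add: algebra_simps)
  qed
  obtain K where K: "0 \<le> K" "\<And>x y. norm (B x y) \<le> K * (norm x * norm y)"
    using bounded_cbilinear_bound[OF B] by metis
  have scaleC: "L (c *\<^sub>C u) = c *\<^sub>C L u" for c u
    by (rule point) (simp add: L scaleC_ptensor.rep_eq bounded_clinear_def scaleC_complex_def)
  have "bounded_linear L"
  proof (rule bounded_linear_intro)
    show "L (u + v) = L u + L v" for u v
      by (rule point) (simp add: L plus_ptensor.rep_eq bounded_clinear_add)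
    show "L (r *\<^sub>R u) = r *\<^sub>R L u" for r u
      using scaleC[of "complex_of_real r" u] by (simp add: scaleC_of_real)
    show "norm (L u) \<le> norm u * K" for u
      using L_bound[OF K] by (simp add: mult.commute)
  qed
  with scaleC have L_lin: "bounded_clinear L" by (simp add: bounded_clinear_def)
  show ?thesis
    by (rule that[OF L_lin L_tensor L_bound])
qed

text \<open>For bounded bilinear \<open>B\<close>, the bounded linear map determined by $a \otimes b \mapsto B(a, b)$.\<close>

definition ptensor_lift ::
    "('a::complex_banach \<Rightarrow> 'b::complex_banach \<Rightarrow> 'c::complex_banach) \<Rightarrow> ('a, 'b) ptensor \<Rightarrow> 'c"
  where "ptensor_lift B = (THE f. bounded_clinear f \<and> (\<forall>a b. f (a \<otimes> b) = B a b))"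

lemma ptensor_lift_eqI:
  assumes "bounded_clinear f" "\<And>a b. f (a \<otimes> b) = B a b"
  shows "ptensor_lift B = f"
  unfolding ptensor_lift_def
  by (rule the_equality) (use assms in \<open>auto intro: ptensor_linear_unique\<close>)

lemma
  assumes "bounded_cbilinear B"
  shows bounded_clinear_ptensor_lift: "bounded_clinear (ptensor_lift B)"
    and ptensor_lift_tensor: "ptensor_lift B (a \<otimes> b) = B a b"
    and norm_ptensor_lift_le: "0 \<le> K \<Longrightarrow> (\<And>a b. norm (B a b) \<le> K * (norm a * norm b)) \<Longrightarrow>
      norm (ptensor_lift B u) \<le> K * norm u"
proof -
  obtain f where f: "bounded_clinear f" "\<And>a b. f (a \<otimes> b) = B a b"
    "\<And>K u. 0 \<le> K \<Longrightarrow> (\<And>a b. norm (B a b) \<le> K * (norm a * norm b)) \<Longrightarrow> norm (f u) \<le> K * norm u"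
    using ptensor_universal[OF assms] by metis
  note eq = ptensor_lift_eqI[OF f(1,2)]
  show "bounded_clinear (ptensor_lift B)" "ptensor_lift B (a \<otimes> b) = B a b"
    "0 \<le> K \<Longrightarrow> (\<And>a b. norm (B a b) \<le> K * (norm a * norm b)) \<Longrightarrow> norm (ptensor_lift B u) \<le> K * norm u"
    using f by (simp_all add: eq)
qed

section \<open>Pseudo-amenability\<close>

definition left_action :: "'a::complex_banach_algebra \<Rightarrow> ('a, 'a) ptensor \<Rightarrow> ('a, 'a) ptensor"
  where "left_action a = ptensor_lift (\<lambda>b c. (a * b) \<otimes> c)"

definition right_action :: "('a, 'a) ptensor \<Rightarrow> 'a::complex_banach_algebra \<Rightarrow> ('a, 'a) ptensor"
  where "right_action u a = ptensor_lift (\<lambda>b c. b \<otimes> (c * a)) u"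

definition diagonal_map :: "('a, 'a) ptensor \<Rightarrow> 'a::complex_banach_algebra"
  where "diagonal_map = ptensor_lift (*)"

lemma bounded_cbilinear_mult:
  "bounded_cbilinear ((*) :: 'a::complex_banach_algebra \<Rightarrow> 'a \<Rightarrow> 'a)"
  by (simp add: bounded_cbilinear_def bounded_bilinear_mult mult_scaleC_left mult_scaleC_right)

lemma bounded_cbilinear_left_action:
  fixes a :: "'a::complex_banach_algebra"
  shows "bounded_cbilinear (\<lambda>b c :: 'a. (a * b) \<otimes> c)"
  using bounded_bilinear.comp1[OF _ bounded_linear_mult_right[of a], of "(\<otimes>)"] bounded_cbilinear_tensor
  by (auto simp: bounded_cbilinear_def mult_scaleC_right)

lemma bounded_cbilinear_right_action:
  fixes a :: "'a::complex_banach_algebra"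
  shows "bounded_cbilinear (\<lambda>b c :: 'a. b \<otimes> (c * a))"
  using bounded_bilinear.comp[OF _ bounded_linear_ident bounded_linear_mult_left[of a], of "(\<otimes>)"]
    bounded_cbilinear_tensor
  by (auto simp: bounded_cbilinear_def mult_scaleC_left)

lemma left_action_tensor: "left_action a (b \<otimes> c) = (a * b) \<otimes> c"
  by (simp add: left_action_def ptensor_lift_tensor bounded_cbilinear_left_action)

lemma right_action_tensor: "right_action (b \<otimes> c) a = b \<otimes> (c * a)"
  by (simp add: right_action_def ptensor_lift_tensor bounded_cbilinear_right_action)

lemma diagonal_map_tensor: "diagonal_map (b \<otimes> c) = b * c"
  by (simp add: diagonal_map_def ptensor_lift_tensor bounded_cbilinear_mult)

text \<open>
  Nets are rendered by proper filters, as usual in Isabelle/HOL. Since every net (over any index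
  type) can be pushed forward to a filter on the tensor product itself, quantifying over filters
  there captures all nets. The lemmas \<open>pseudo_amenable_if_net\<close> and \<open>pseudo_amenable_imp_net\<close> below
  spell out the equivalence with nets indexed by directed sets. No boundedness is required.
\<close>

definition approximate_diagonal ::
    "('x \<Rightarrow> ('a::complex_banach_algebra, 'a) ptensor) \<Rightarrow> 'x filter \<Rightarrow> bool"
  where "approximate_diagonal n F \<longleftrightarrow> F \<noteq> bot \<and>
    (\<forall>a. ((\<lambda>i. left_action a (n i) - right_action (n i) a) \<longlongrightarrow> 0) F \<and>
         ((\<lambda>i. diagonal_map (n i) * a) \<longlongrightarrow> a) F)"

definition pseudo_amenable :: "'a::complex_banach_algebra itself \<Rightarrow> bool"
  where "pseudo_amenable _ \<longleftrightarrow>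
    (\<exists>F :: ('a, 'a) ptensor filter. approximate_diagonal (\<lambda>u. u) F)"

lemma pseudo_amenableI:
  fixes n :: "'x \<Rightarrow> ('a::complex_banach_algebra, 'a) ptensor"
  assumes "approximate_diagonal n F"
  shows "pseudo_amenable TYPE('a)"
  using assms unfolding pseudo_amenable_def approximate_diagonal_def
  by (intro exI[of _ "filtermap n F"]) (auto simp: filterlim_filtermap filtermap_bot_iff)

definition net_approximate_diagonal ::
    "'x set \<Rightarrow> ('x \<Rightarrow> 'x \<Rightarrow> bool) \<Rightarrow> ('x \<Rightarrow> ('a::complex_banach_algebra, 'a) ptensor) \<Rightarrow> bool"
  where "net_approximate_diagonal D le n \<longleftrightarrow>
    D \<noteq> {} \<and> (\<forall>i\<in>D. le i i) \<and> (\<forall>i\<in>D. \<forall>j\<in>D. \<forall>k\<in>D. le i j \<longrightarrow> le j k \<longrightarrow> le i k) \<and>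
    (\<forall>i\<in>D. \<forall>j\<in>D. \<exists>k\<in>D. le i k \<and> le j k) \<and>
    (\<forall>a. \<forall>e>0. \<exists>i\<in>D. \<forall>j\<in>D. le i j \<longrightarrow>
      norm (left_action a (n j) - right_action (n j) a) < e \<and> norm (diagonal_map (n j) * a - a) < e)"

lemma pseudo_amenable_if_net:
  fixes n :: "'x \<Rightarrow> ('a::complex_banach_algebra, 'a) ptensor"
  assumes "net_approximate_diagonal D le n"
  shows "pseudo_amenable TYPE('a)"
proof (rule pseudo_amenableI)
  define F where "F = (INF i\<in>D. principal {j\<in>D. le i j})"
  note net = assms[unfolded net_approximate_diagonal_def]
  have ev: "eventually P F \<longleftrightarrow> (\<exists>i\<in>D. \<forall>j\<in>D. le i j \<longrightarrow> P j)" for P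
    unfolding F_def
  proof (subst eventually_INF_base)
    show "D \<noteq> {}" using net by blast
    fix i j assume ij: "i \<in> D" "j \<in> D"
    then obtain k where k: "k \<in> D" "le i k" "le j k" using net by metis
    have "{l\<in>D. le k l} \<subseteq> {l\<in>D. le i l} \<inter> {l\<in>D. le j l}"
      using net k ij by blast
    with k show "\<exists>k\<in>D. principal {l\<in>D. le k l} \<le> inf (principal {l\<in>D. le i l}) (principal {l\<in>D. le j l})"
      by auto
  qed (auto simp: eventually_principal)
  have conv: "\<forall>a. \<forall>e>0. \<exists>i\<in>D. \<forall>j\<in>D. le i j \<longrightarrow>
      norm (left_action a (n j) - right_action (n j) a) < e \<and> norm (diagonal_map (n j) * a - a) < e"
    using net by (elim conjE)
  have "\<not> eventually (\<lambda>_. False) F"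
    unfolding ev using net by blast
  then have "F \<noteq> bot" by (auto simp: trivial_limit_def)
  moreover have "((\<lambda>i. left_action a (n i) - right_action (n i) a) \<longlongrightarrow> 0) F"
    "((\<lambda>i. diagonal_map (n i) * a) \<longlongrightarrow> a) F" for a
  proof -
    have *: "\<exists>i\<in>D. \<forall>j\<in>D. le i j \<longrightarrow>
        norm (left_action a (n j) - right_action (n j) a) < e \<and> norm (diagonal_map (n j) * a - a) < e"
      if "0 < e" for e
      using conv[THEN spec, of a, THEN spec, of e, THEN mp, OF that] .
    show "((\<lambda>i. left_action a (n i) - right_action (n i) a) \<longlongrightarrow> 0) F"
      "((\<lambda>i. diagonal_map (n i) * a) \<longlongrightarrow> a) F"
      unfolding tendsto_iff ev dist_norm diff_zero using * by blast+
  qed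
  ultimately show "approximate_diagonal n F"
    by (simp add: approximate_diagonal_def)
qed

lemma pseudo_amenable_imp_net:
  assumes "pseudo_amenable TYPE('a::complex_banach_algebra)"
  shows "\<exists>(D :: (('a, 'a) ptensor \<times> ('a, 'a) ptensor set) set) le
    (n :: ('a, 'a) ptensor \<times> ('a, 'a) ptensor set \<Rightarrow> ('a, 'a) ptensor). net_approximate_diagonal D le n"
proof -
  obtain F :: "('a, 'a) ptensor filter" where F: "approximate_diagonal (\<lambda>u. u) F"
    using assms by (auto simp: pseudo_amenable_def)
  then have ne: "F \<noteq> bot" by (simp add: approximate_diagonal_def)
  define D where "D = {(u, P). u \<in> P \<and> eventually (\<lambda>v. v \<in> P) F}"
  define le where "le x y \<longleftrightarrow> snd y \<subseteq> snd x" for x y :: "('a, 'a) ptensor \<times> ('a, 'a) ptensor set"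
  have mem: "\<exists>u. (u, P) \<in> D" if "eventually (\<lambda>v. v \<in> P) F" for P
    using eventually_happens'[OF ne that] that by (auto simp: D_def)
  have "net_approximate_diagonal D le fst"
    unfolding net_approximate_diagonal_def
  proof (intro conjI ballI allI impI)
    show "D \<noteq> {}" using mem[of UNIV] by auto
    show "le i i" for i by (simp add: le_def)
    show "le i k" if "le i j" "le j k" for i j k using that by (auto simp: le_def)
    show "\<exists>k\<in>D. le i k \<and> le j k" if "i \<in> D" "j \<in> D" for i j
    proof -
      have "eventually (\<lambda>v. v \<in> snd i \<inter> snd j) F"
        using that by (auto simp: D_def eventually_conj_iff)
      then obtain u where "(u, snd i \<inter> snd j) \<in> D" using mem by blast
      then show ?thesis by (rule bexI[rotated]) (simp add: le_def)
    qed
    fix a :: 'a and e :: real assume e: "0 < e"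
    define P where "P = {u. norm (left_action a u - right_action u a) < e \<and> norm (diagonal_map u * a - a) < e}"
    have "((\<lambda>u. left_action a u - right_action u a) \<longlongrightarrow> 0) F" "((\<lambda>u. diagonal_map u * a) \<longlongrightarrow> a) F"
      using F by (auto simp: approximate_diagonal_def)
    from this[THEN tendstoD, OF e]
    have "eventually (\<lambda>u. dist (left_action a u - right_action u a) 0 < e) F"
      "eventually (\<lambda>u. dist (diagonal_map u * a) a < e) F"
      by this+
    then have "eventually (\<lambda>u. u \<in> P) F"
      by (simp add: P_def dist_norm eventually_conj_iff)
    from mem[OF this] obtain u where "(u, P) \<in> D" by blast
    moreover have "fst j \<in> P" if "j \<in> D" "le (u, P) j" for j
      using that by (auto simp: D_def le_def)
    ultimately show "\<exists>i\<in>D. \<forall>j\<in>D. le i j \<longrightarrow>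
        norm (left_action a (fst j) - right_action (fst j) a) < e \<and> norm (diagonal_map (fst j) * a - a) < e"
      unfolding P_def by blast
  qed
  then show ?thesis by blast
qed

section \<open>Amenable groups and Brandt semigroups\<close>

text \<open>
  Groups are taken from the class of not necessarily commutative additive groups: the
  group product $gg'$ is written \<open>g + g'\<close> and the translate of \<open>f\<close> by \<open>g\<close> is \<open>\<lambda>x. f (g + x)\<close>.
  As the group is discrete, $\ell^\infty(G)$ consists of all bounded functions; a mean is
  constrained on these only.
\<close>

definition left_invariant_mean :: "(('g::group_add \<Rightarrow> real) \<Rightarrow> real) \<Rightarrow> bool"
  where "left_invariant_mean m \<longleftrightarrow>
    (\<forall>f h. bounded (range f) \<longrightarrow> bounded (range h) \<longrightarrow> m (\<lambda>x. f x + h x) = m f + m h) \<and>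
    (\<forall>c f. bounded (range f) \<longrightarrow> m (\<lambda>x. c * f x) = c * m f) \<and>
    (\<forall>f. bounded (range f) \<longrightarrow> (\<forall>x. 0 \<le> f x) \<longrightarrow> 0 \<le> m f) \<and>
    m (\<lambda>_. 1) = 1 \<and>
    (\<forall>g f. bounded (range f) \<longrightarrow> m (\<lambda>x. f (g + x)) = m f)"

definition amenable_group :: "'g::group_add itself \<Rightarrow> bool"
  where "amenable_group _ \<longleftrightarrow> (\<exists>m :: ('g \<Rightarrow> real) \<Rightarrow> real. left_invariant_mean m)"

text \<open>\<open>Null\<close> is the adjoined element $o$; the index set is the (nonempty) type \<open>'i\<close>.\<close>

datatype ('i, 'g) brandt = Null | Elem 'i 'g 'i

instantiation brandt :: (type, group_add) semigroup_mult
begin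

fun times_brandt :: "('a, 'b) brandt \<Rightarrow> ('a, 'b) brandt \<Rightarrow> ('a, 'b) brandt"
  where
    "Elem i g j * Elem i' g' j' = (if j = i' then Elem i (g + g') j' else Null)"
  | "Null * Elem i g j = Null"
  | "Elem i g j * Null = Null"
  | "Null * Null = Null"

instance
proof
  fix s t u :: "('a, 'b) brandt"
  show "s * t * u = s * (t * u)"
    by (cases s; cases t; cases u) (auto simp: add.assoc)
qed

end

end

theory Submission
  imports Defs "HOL-Analysis.Elementary_Normed_Spaces" "HOL-Analysis.Convex"
begin

text \<open>
  The group is written multiplicatively in this overview and additively in the formal text.
  Write $e_{ij}(g) = \delta_{(i,g,j)} - \delta_o$. These elements multiply like matrix units,
  $e_{ij}(g)\,e_{jl}(h) = e_{il}(gh)$ with all other products zero, and they are annihilated by the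
  central idempotent $\delta_o$. So $\ell^1(S)$ is the sum of $\mathbb{C}\delta_o$ and an algebra
  of matrices over $\ell^1(G)$ indexed by $I$. Fix $k \in I$, a finite set $F \subseteq I$ and a
  finitely supported probability $p$ on $G$, and put
  \[ u = \sum_{i \in F} \sum_g p(g)\, e_{ik}(g) \otimes e_{ki}(g^{-1}) + \delta_o \otimes \delta_o . \]

  For $i, j \in F$ the commutator of $u$ with $\delta_{(i,h,j)}$ is
  $\sum_g p(g) (T(hg) - T(g))$ with $T(x) = e_{ik}(x) \otimes e_{kj}(x^{-1}h)$, which is small as
  soon as $p$ is almost invariant under $h$; and $\pi(u) = \sum_{i \in F} e_{ii}(1) + \delta_o$
  fixes $\delta_{(i,h,j)}$. Although $\|u\|$ may grow with $F$, for every point mass the commutator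
  and the error $\pi(u)\delta_s - \delta_s$ are bounded by an absolute constant, because at most
  one summand over $F$ survives on each side. Hence smallness on finitely many point masses passes
  to all of $\ell^1(S)$, where finitely supported elements are dense (\<open>pseudo_amenable_l1I\<close>).

  Almost invariant probabilities come from the invariant mean (\<open>almost_invariant_l1\<close>). If for a
  finite $E \subseteq G$ the vectors $w_g = \sum_{h \in E} (\delta_{(h,hg)} - \delta_{(h,g)})$ in
  $\ell^1(G \times G)$ had no convex combinations near zero, a bounded functional $f$ would
  satisfy $f(w_g) \ge \epsilon > 0$ for all $g$; but $g \mapsto f(w_g)$ is a finite sum of
  functions of the form $\phi(hg) - \phi(g)$ with $\phi$ bounded, so its mean is zero.
\<close>

section \<open>Separation of a convex set from the origin\<close>

text \<open>
  The geometric Hahn--Banach theorem. The sublinear gauge is $q(x) = \inf \|x + tc\| - td$ over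
  $t \ge 0$ and $c \in C$: it lies below the norm and satisfies $q(-c) \le -d$ on $C$, so any
  linear functional below $q$ is bounded by the norm and at least $d$ on $C$.
\<close>

lemma convex_separated_from_zero:
  fixes C :: "'a::real_normed_vector set"
  assumes "convex C" "C \<noteq> {}" and far: "\<And>c. c \<in> C \<Longrightarrow> d \<le> norm c"
  obtains f :: "'a \<Rightarrow> real" where "linear f" "\<And>x. \<bar>f x\<bar> \<le> norm x" "\<And>c. c \<in> C \<Longrightarrow> d \<le> f c"
proof -
  define S where "S x = {norm (x + t *\<^sub>R c) - t * d | t c. 0 \<le> t \<and> c \<in> C}" for x
  define q where "q x = Inf (S x)" for x
  have lb: "- norm x \<le> z" if z: "z \<in> S x" for x z
  proof -
    obtain t c where tc: "0 \<le> t" "c \<in> C" "z = norm (x + t *\<^sub>R c) - t * d"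
      using z by (auto simp: S_def)
    have "t * d \<le> norm (t *\<^sub>R c)"
      using tc far[of c] by (simp add: mult_left_mono)
    moreover have "norm (t *\<^sub>R c) \<le> norm (x + t *\<^sub>R c) + norm x"
      using norm_triangle_ineq4[of "x + t *\<^sub>R c" x] by simp
    ultimately show ?thesis using tc by simp
  qed
  then have bdd: "bdd_below (S x)" for x
    by (meson bdd_belowI)
  have ne: "S x \<noteq> {}" for x
    using \<open>C \<noteq> {}\<close> by (auto simp: S_def)
  have le: "q x \<le> norm (x + t *\<^sub>R c) - t * d" if "0 \<le> t" "c \<in> C" for x t c
    unfolding q_def using that by (intro cInf_lower bdd) (auto simp: S_def)
  have ge: "b \<le> q x" if "\<And>t c. 0 \<le> t \<Longrightarrow> c \<in> C \<Longrightarrow> b \<le> norm (x + t *\<^sub>R c) - t * d" for b x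
    unfolding q_def using that by (intro cInf_greatest ne) (auto simp: S_def)
  have q_norm: "q x \<le> norm x" for x
    using le[of 0 _ x] \<open>C \<noteq> {}\<close> by auto
  have add: "q (x + z) \<le> q x + q z" for x z
  proof -
    have *: "q (x + z) \<le> (norm (x + t *\<^sub>R c) - t * d) + (norm (z + s *\<^sub>R b) - s * d)"
      if ts: "0 \<le> t" "c \<in> C" "0 \<le> s" "b \<in> C" for t c s b
    proof -
      \<comment> \<open>Convexity: the nonnegative multiples of \<open>C\<close> are closed under addition.\<close>
      obtain a where a: "a \<in> C" "(t + s) *\<^sub>R a = t *\<^sub>R c + s *\<^sub>R b"
      proof (cases "t + s = 0")
        case True
        with ts that show ?thesis by (simp add: add_nonneg_eq_0_iff)
      next
        case False
        have "(t / (t + s)) *\<^sub>R c + (s / (t + s)) *\<^sub>R b \<in> C"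
          using False ts \<open>convex C\<close> by (intro convexD) (auto simp flip: add_divide_distrib)
        then show ?thesis
          using False by (intro that[of "(t / (t + s)) *\<^sub>R c + (s / (t + s)) *\<^sub>R b"])
            (auto simp: scaleR_add_right)
      qed
      have "q (x + z) \<le> norm ((x + z) + (t + s) *\<^sub>R a) - (t + s) * d"
        using ts a by (intro le) auto
      also have "(x + z) + (t + s) *\<^sub>R a = (x + t *\<^sub>R c) + (z + s *\<^sub>R b)"
        unfolding a(2) by simp
      finally show ?thesis
        using norm_triangle_ineq[of "x + t *\<^sub>R c" "z + s *\<^sub>R b"] by (simp add: algebra_simps)
    qed
    have "q (x + z) - (norm (x + t *\<^sub>R c) - t * d) \<le> q z" if "0 \<le> t" "c \<in> C" for t c
      using *[OF that] by (intro ge) (simp add: algebra_simps)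
    then have "q (x + z) - q z \<le> q x"
      by (intro ge) (simp add: algebra_simps)
    then show ?thesis by simp
  qed
  have scale_le: "q (r *\<^sub>R x) \<le> r * q x" if r: "0 < r" for r x
  proof -
    have "q (r *\<^sub>R x) / r \<le> q x"
    proof (rule ge)
      fix t :: real and c assume t: "0 \<le> t" "c \<in> C"
      have "q (r *\<^sub>R x) \<le> norm (r *\<^sub>R x + (r * t) *\<^sub>R c) - (r * t) * d"
        using t r by (intro le) auto
      also have "r *\<^sub>R x + (r * t) *\<^sub>R c = r *\<^sub>R (x + t *\<^sub>R c)"
        by (simp add: algebra_simps)
      finally have "q (r *\<^sub>R x) \<le> r * (norm (x + t *\<^sub>R c) - t * d)"
        unfolding norm_scaleR using r by (simp add: right_diff_distrib)
      then show "q (r *\<^sub>R x) / r \<le> norm (x + t *\<^sub>R c) - t * d"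
        using r by (simp add: pos_divide_le_eq mult.commute)
    qed
    then show ?thesis using r by (simp add: field_simps)
  qed
  have scale: "q (r *\<^sub>R x) = r * q x" if "0 \<le> r" for r x
  proof (cases "r = 0")
    case True
    have "0 \<le> q 0"
      by (rule ge) (simp add: far mult_left_mono)
    with q_norm[of 0] True show ?thesis by simp
  next
    case False
    with that have r: "0 < r" by simp
    \<comment> \<open>The converse inequality is \<open>scale_le\<close> for the inverse factor.\<close>
    have "q ((1 / r) *\<^sub>R (r *\<^sub>R x)) \<le> (1 / r) * q (r *\<^sub>R x)"
      using r by (intro scale_le) auto
    then have "r * q x \<le> q (r *\<^sub>R x)"
      using r by (simp add: field_simps)
    with scale_le[OF r] show ?thesis by (simp add: antisym)
  qed
  have "sublinear q"
    using add scale by (auto simp: sublinear_def)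
  then obtain f where f: "linear f" "\<And>x. f x \<le> q x"
    using sublinear_supporting_linear by metis
  show ?thesis
  proof (rule that[OF f(1)])
    show "\<bar>f x\<bar> \<le> norm x" for x
      using order_trans[OF f(2) q_norm, of x] order_trans[OF f(2) q_norm, of "- x"]
      by (simp add: linear_neg[OF f(1)])
    show "d \<le> f c" if "c \<in> C" for c
      using order_trans[OF f(2) le[OF _ that, of 1 "- c"]] linear_neg[OF f(1), of c] by simp
  qed
qed

section \<open>Bounded linear maps on the semigroup algebra\<close>

lemma l1_fun_sum: "l1_fun (sum u A) s = (\<Sum>k\<in>A. l1_fun (u k) s)"
  by (induction A rule: infinite_finite_induct) (simp_all add: zero_l1.rep_eq plus_l1.rep_eq)

lemma norm_point_mass: "norm (point_mass s) = 1"
proof -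
  have "norm (point_mass s) = (\<Sum>\<^sub>\<infinity>t\<in>{s}. 1)"
    unfolding norm_l1_def by (rule infsum_cong_neutral) (auto simp: point_mass.rep_eq)
  then show ?thesis by simp
qed

lemma l1_has_sum_point_masses: "((\<lambda>s. l1_fun a s *\<^sub>C point_mass s) has_sum a) UNIV"
proof -
  have err: "norm ((\<Sum>s\<in>X. l1_fun a s *\<^sub>C point_mass s) - a) = norm a - (\<Sum>s\<in>X. cmod (l1_fun a s))"
    if X: "finite X" for X
  proof -
    have "l1_fun ((\<Sum>s\<in>X. l1_fun a s *\<^sub>C point_mass s) - a) t = (if t \<in> X then 0 else - l1_fun a t)" for t
      using X by (simp add: minus_l1.rep_eq l1_fun_sum scaleC_l1.rep_eq point_mass.rep_eq
          if_distrib sum.delta' cong: if_cong)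
    then have "norm ((\<Sum>s\<in>X. l1_fun a s *\<^sub>C point_mass s) - a) = (\<Sum>\<^sub>\<infinity>t\<in>UNIV - X. cmod (l1_fun a t))"
      unfolding norm_l1_def by (intro infsum_cong_neutral) auto
    also have "\<dots> = norm a - (\<Sum>s\<in>X. cmod (l1_fun a s))"
      using X by (subst infsum_Diff) (auto simp: l1_fun_abs_summable norm_l1_def)
    finally show ?thesis .
  qed
  have "((\<lambda>s. cmod (l1_fun a s)) has_sum norm a) UNIV"
    unfolding norm_l1_def by (rule has_sum_infsum[OF l1_fun_abs_summable])
  then have "((\<lambda>X. norm a - (\<Sum>s\<in>X. cmod (l1_fun a s))) \<longlongrightarrow> norm a - norm a) (finite_subsets_at_top UNIV)"
    unfolding has_sum_def by (intro tendsto_diff tendsto_const)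
  moreover have "\<forall>\<^sub>F X in finite_subsets_at_top UNIV.
      norm a - (\<Sum>s\<in>X. cmod (l1_fun a s)) = norm ((\<Sum>s\<in>X. l1_fun a s *\<^sub>C point_mass s) - a)"
    by (rule eventually_finite_subsets_at_top_weakI) (simp add: err)
  ultimately have "((\<lambda>X. norm ((\<Sum>s\<in>X. l1_fun a s *\<^sub>C point_mass s) - a)) \<longlongrightarrow> 0) (finite_subsets_at_top UNIV)"
    by (simp add: Lim_transform_eventually)
  then show ?thesis
    unfolding has_sum_def by (rule LIM_zero_cancel[OF tendsto_norm_zero_cancel])
qed

text \<open>
  A bounded operator is controlled by its values at the point masses. This form serves families of
  operators that share the crude bound \<open>K\<close> and become small on each finite set \<open>X\<close>: the mass
  of \<open>a\<close> off \<open>X\<close> then absorbs \<open>K\<close>.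
\<close>

lemma l1_operator_bound:
  fixes L :: "'s l1 \<Rightarrow> 'b::complex_banach"
  assumes L: "bounded_clinear L" and "0 \<le> e"
    and small: "\<And>s. s \<in> X \<Longrightarrow> norm (L (point_mass s)) \<le> e"
    and bound: "\<And>s. norm (L (point_mass s)) \<le> K"
  shows "norm (L a) \<le> e * norm a + K * (\<Sum>\<^sub>\<infinity>s\<in>- X. cmod (l1_fun a s))"
proof (rule norm_infsum_le)
  have "((\<lambda>s. L (l1_fun a s *\<^sub>C point_mass s)) has_sum L a) UNIV"
    using L by (intro has_sum_bounded_linear[OF _ l1_has_sum_point_masses]) (simp add: bounded_clinear_def)
  then show "((\<lambda>s. l1_fun a s *\<^sub>C L (point_mass s)) has_sum L a) UNIV"
    using L by (simp add: bounded_clinear_def)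
  have "((\<lambda>s. cmod (l1_fun a s)) has_sum norm a) UNIV"
    unfolding norm_l1_def by (rule has_sum_infsum[OF l1_fun_abs_summable])
  moreover have "((\<lambda>s. cmod (l1_fun a s)) has_sum (\<Sum>\<^sub>\<infinity>s\<in>- X. cmod (l1_fun a s))) (- X)"
    by (intro has_sum_infsum summable_on_subset[OF l1_fun_abs_summable]) auto
  then have "((\<lambda>s. if s \<in> X then 0 else cmod (l1_fun a s)) has_sum (\<Sum>\<^sub>\<infinity>s\<in>- X. cmod (l1_fun a s))) UNIV"
    by (subst has_sum_cong_neutral[where T = "- X" and g = "\<lambda>s. cmod (l1_fun a s)"]) auto
  ultimately show "((\<lambda>s. e * cmod (l1_fun a s) + K * (if s \<in> X then 0 else cmod (l1_fun a s)))
      has_sum e * norm a + K * (\<Sum>\<^sub>\<infinity>s\<in>- X. cmod (l1_fun a s))) UNIV"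
    by (intro has_sum_add has_sum_cmult_right)
  show "norm (l1_fun a s *\<^sub>C L (point_mass s)) \<le>
      e * cmod (l1_fun a s) + K * (if s \<in> X then 0 else cmod (l1_fun a s))" for s
  proof (cases "s \<in> X")
    case True
    then show ?thesis
      using mult_left_mono[OF small[of s], of "cmod (l1_fun a s)"] by (simp add: norm_scaleC mult.commute)
  next
    case False
    have "0 \<le> e * cmod (l1_fun a s)"
      using \<open>0 \<le> e\<close> by simp
    with False show ?thesis
      using mult_left_mono[OF bound[of s], of "cmod (l1_fun a s)"] by (simp add: norm_scaleC mult.commute)
  qed
qed

text \<open>
  The universal property of $\ell^1$; it turns a norm estimate in $\ell^1$ into one in an arbitrary
  Banach space.
\<close>

lemma l1_extension:
  fixes T :: "'s \<Rightarrow> 'b::complex_banach"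
  assumes T: "\<And>s. norm (T s) \<le> K"
  obtains L :: "'s l1 \<Rightarrow> 'b" where "bounded_linear L" "\<And>s. L (point_mass s) = T s"
    "\<And>a. norm (L a) \<le> K * norm a"
proof -
  define L where "L a = (\<Sum>\<^sub>\<infinity>s. l1_fun a s *\<^sub>C T s)" for a
  have le: "norm (l1_fun a s *\<^sub>C T s) \<le> K * cmod (l1_fun a s)" for a s
    using mult_left_mono[OF T[of s], of "cmod (l1_fun a s)"] by (simp add: norm_scaleC mult.commute)
  have dom: "(\<lambda>s. K * cmod (l1_fun a s)) summable_on UNIV" for a
    by (rule summable_on_cmult_right[OF l1_fun_abs_summable])
  have summ: "(\<lambda>s. l1_fun a s *\<^sub>C T s) summable_on UNIV" for a
    by (rule abs_summable_summable[OF summable_on_comparison_test[OF dom[of a]]]) (use le in auto)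
  have bound: "norm (L a) \<le> K * norm a" for a
  proof (rule norm_infsum_le)
    show "((\<lambda>s. l1_fun a s *\<^sub>C T s) has_sum L a) UNIV"
      unfolding L_def by (rule has_sum_infsum[OF summ])
    show "((\<lambda>s. K * cmod (l1_fun a s)) has_sum K * norm a) UNIV"
      unfolding norm_l1_def by (intro has_sum_cmult_right has_sum_infsum l1_fun_abs_summable)
  qed (rule le)
  have "bounded_linear L"
  proof (rule bounded_linear_intro)
    show "L (a + b) = L a + L b" for a b
      by (simp add: L_def plus_l1.rep_eq scaleC_add_left infsum_add[OF summ summ])
    show "L (r *\<^sub>R a) = r *\<^sub>R L a" for r a
    proof -
      have "(r *\<^sub>R z) *\<^sub>C x = r *\<^sub>R (z *\<^sub>C x)" for z and x :: 'b
        by (metis scaleC_of_real scaleC_scaleC scaleR_conv_of_real)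
      then show ?thesis
        by (simp add: L_def scaleR_l1.rep_eq infsum_scaleR_right)
    qed
    show "norm (L a) \<le> norm a * K" for a
      using bound by (simp add: mult.commute)
  qed
  moreover have "L (point_mass s) = T s" for s
  proof -
    have "0 *\<^sub>C x = 0" for x :: 'b
      using scaleC_of_real[of 0 x] by simp
    then have "L (point_mass s) = (\<Sum>\<^sub>\<infinity>t\<in>{s}. T s)"
      unfolding L_def by (intro infsum_cong_neutral) (auto simp: point_mass.rep_eq)
    then show ?thesis by simp
  qed
  ultimately show ?thesis using bound that by blast
qed

section \<open>Almost invariant convex combinations\<close>

lemma left_invariant_mean_const:
  assumes "left_invariant_mean m"
  shows "m (\<lambda>_. c) = c"
proof -
  have "\<And>f. bounded (range f) \<Longrightarrow> m (\<lambda>x. c * f x) = c * m f" "m (\<lambda>_. 1) = 1"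
    using assms by (simp_all add: left_invariant_mean_def)
  from this(1)[of "\<lambda>_. 1"] this(2) show ?thesis by simp
qed

lemma left_invariant_mean_sum_zero:
  assumes m: "left_invariant_mean m" and "finite E"
    and f: "\<And>h. h \<in> E \<Longrightarrow> bounded (range (f h)) \<and> m (f h) = 0"
  shows "bounded (range (\<lambda>x. \<Sum>h\<in>E. f h x)) \<and> m (\<lambda>x. \<Sum>h\<in>E. f h x) = 0"
  using \<open>finite E\<close> f
proof (induction E)
  case empty
  show ?case by (simp add: left_invariant_mean_const[OF m])
next
  case (insert h E)
  then have IH: "bounded (range (\<lambda>x. \<Sum>h\<in>E. f h x))" "m (\<lambda>x. \<Sum>h\<in>E. f h x) = 0"
    and h: "bounded (range (f h))" "m (f h) = 0"
    by auto
  have "m (\<lambda>x. f h x + (\<Sum>h\<in>E. f h x)) = m (f h) + m (\<lambda>x. \<Sum>h\<in>E. f h x)"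
    using m h(1) IH(1) unfolding left_invariant_mean_def by blast
  moreover have "bounded (range (\<lambda>x. f h x + (\<Sum>h\<in>E. f h x)))"
    using h(1) IH(1) by (rule bounded_plus_comp)
  ultimately show ?case
    using insert.hyps h(2) IH(2) by simp
qed

lemma left_invariant_mean_translate_diff:
  assumes m: "left_invariant_mean m" and f: "bounded (range f)"
  shows "bounded (range (\<lambda>x. f (h + x) - f x)) \<and> m (\<lambda>x. f (h + x) - f x) = 0"
proof -
  have fh: "bounded (range (\<lambda>x. f (h + x)))"
    by (rule bounded_subset[OF f]) auto
  have nf: "bounded (range (\<lambda>x. - 1 * f x))"
    using f by simp
  have "m (\<lambda>x. f (h + x) + - 1 * f x) = m (\<lambda>x. f (h + x)) + m (\<lambda>x. - 1 * f x)"
    using m fh nf unfolding left_invariant_mean_def by blast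
  also have "m (\<lambda>x. - 1 * f x) = - 1 * m f"
    using m f unfolding left_invariant_mean_def by blast
  also have "m (\<lambda>x. f (h + x)) = m f"
    using m f unfolding left_invariant_mean_def by blast
  finally show ?thesis
    using bounded_minus_comp[OF fh f] by simp
qed

lemma left_invariant_mean_ge:
  assumes m: "left_invariant_mean m" and f: "bounded (range f)" and ge: "\<And>x. d \<le> f x"
  shows "d \<le> m f"
proof -
  have add: "bounded (range g) \<Longrightarrow> m (\<lambda>x. f x + g x) = m f + m g"
    and pos: "bounded (range g) \<Longrightarrow> (\<forall>x. 0 \<le> g x) \<Longrightarrow> 0 \<le> m g" for g
    using m f by (simp_all add: left_invariant_mean_def)
  have "0 \<le> m (\<lambda>x. f x + - d)"
    using ge bounded_plus_comp[OF f, of "\<lambda>_. - d"] by (intro pos) simp_all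
  also have "m (\<lambda>x. f x + - d) = m f + m (\<lambda>_. - d)"
    by (rule add) simp
  also have "m (\<lambda>_. - d) = - d"
    by (rule left_invariant_mean_const[OF m])
  finally show ?thesis by simp
qed

text \<open>
  The Hahn--Banach argument of Day and Namioka: the first coordinate of $G \times G$ keeps the
  finitely many conditions $h \in E$ apart, so that one separation handles them simultaneously.
\<close>

lemma almost_invariant_l1:
  fixes E :: "'g::group_add set"
  assumes "amenable_group TYPE('g)" "finite E" "0 < e"
  defines "w \<equiv> \<lambda>g. \<Sum>h\<in>E. point_mass (h, h + g) - point_mass (h, g)"
  obtains A :: "'g set" and p :: "'g \<Rightarrow> real"
  where "\<forall>g\<in>A. 0 \<le> p g" "sum p A = 1" "norm (\<Sum>g\<in>A. p g *\<^sub>R w g) < e"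
proof -
  obtain m :: "('g \<Rightarrow> real) \<Rightarrow> real" where m: "left_invariant_mean m"
    using assms(1) by (auto simp: amenable_group_def)
  have "\<exists>c \<in> convex hull (range w). norm c < e"
  proof (rule ccontr)
    assume "\<not> ?thesis"
    then have far: "\<And>c. c \<in> convex hull (range w) \<Longrightarrow> e \<le> norm c" by force
    have ne: "convex hull (range w) \<noteq> {}"
      using hull_inc[of "w 0" "range w" convex] by blast
    obtain f where f: "linear f" "\<And>x. \<bar>f x\<bar> \<le> norm x"
        "\<And>c. c \<in> convex hull (range w) \<Longrightarrow> e \<le> f c"
      using convex_separated_from_zero[OF convex_convex_hull ne far] by metis
    define F where "F h g = f (point_mass (h, g))" for h g
    have bnd: "bounded (range (F h))" for h
      using f(2)[of "point_mass (h, _)"] by (intro boundedI[of _ 1]) (auto simp: F_def norm_point_mass)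
    have fw: "f (w g) = (\<Sum>h\<in>E. F h (h + g) - F h g)" for g
      by (simp add: w_def F_def linear_sum[OF f(1)] linear_diff[OF f(1)])
    have ge: "e \<le> (\<Sum>h\<in>E. F h (h + g) - F h g)" for g
      using f(3)[of "w g"] by (simp add: fw hull_inc)
    have mean: "bounded (range (\<lambda>g. \<Sum>h\<in>E. F h (h + g) - F h g)) \<and> m (\<lambda>g. \<Sum>h\<in>E. F h (h + g) - F h g) = 0"
      by (intro left_invariant_mean_sum_zero[OF m \<open>finite E\<close>] left_invariant_mean_translate_diff[OF m bnd])
    then have "e \<le> 0"
      using left_invariant_mean_ge[OF m, of "\<lambda>g. \<Sum>h\<in>E. F h (h + g) - F h g", OF _ ge] by simp
    with \<open>0 < e\<close> show False by simp
  qed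
  then obtain c where hull: "c \<in> convex hull (range w)" and c: "norm c < e"
    by (elim bexE)
  from hull obtain S u where "finite S \<and> S \<subseteq> range w \<and> (\<forall>x\<in>S. 0 \<le> u x) \<and> sum u S = 1 \<and>
      (\<Sum>v\<in>S. u v *\<^sub>R v) = c"
    unfolding convex_hull_explicit mem_Collect_eq by (elim exE) (rule that)
  then have S: "S \<subseteq> range w" "\<And>x. x \<in> S \<Longrightarrow> 0 \<le> u x" "sum u S = 1"
    and sum_c: "(\<Sum>v\<in>S. u v *\<^sub>R v) = c"
    by simp_all
  define r where "r = inv w"
  have r: "w (r v) = v" if "v \<in> S" for v
    using S(1) that unfolding r_def by (intro f_inv_into_f) blast
  have inj: "inj_on r S"
    by (rule inj_on_inverseI[of _ w]) (rule r)
  show ?thesis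
  proof (rule that[of "r ` S" "\<lambda>g. u (w g)"])
    have "(\<Sum>g\<in>r ` S. u (w g) *\<^sub>R w g) = (\<Sum>v\<in>S. u v *\<^sub>R v)"
      by (rule sum.reindex_cong[OF inj refl]) (simp only: r)
    then show "norm (\<Sum>g\<in>r ` S. u (w g) *\<^sub>R w g) < e"
      by (simp only: sum_c c)
    have "(\<Sum>g\<in>r ` S. u (w g)) = sum u S"
      by (rule sum.reindex_cong[OF inj refl]) (simp only: r)
    then show "(\<Sum>g\<in>r ` S. u (w g)) = 1"
      by (simp only: S(3))
    show "\<forall>g\<in>r ` S. 0 \<le> u (w g)"
      by (simp add: r S(2))
  qed
qed

text \<open>
  Almost invariance in the form in which it is applied, to bounded functions with values in a
  Banach space. The bound is uniform over these functions because each of them induces an operator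
  on $\ell^1(G \times G)$ that maps $w_g$ to $T(hg) - T(g)$.
\<close>

lemma almost_invariant_combination:
  fixes E :: "'g::group_add set"
  assumes "amenable_group TYPE('g)" "finite E" "0 < e"
  obtains A :: "'g set" and p :: "'g \<Rightarrow> real"
  where "\<forall>g\<in>A. 0 \<le> p g" "sum p A = 1"
    "\<forall>h\<in>E. \<forall>(T :: 'g \<Rightarrow> 'b::complex_banach) K. (\<forall>x. norm (T x) \<le> K) \<longrightarrow>
      norm (\<Sum>g\<in>A. p g *\<^sub>R (T (h + g) - T g)) \<le> K * e"
proof -
  define w :: "'g \<Rightarrow> ('g \<times> 'g) l1" where "w g = (\<Sum>h\<in>E. point_mass (h, h + g) - point_mass (h, g))" for g
  obtain A p where A: "\<forall>g\<in>A. 0 \<le> p g" "sum p A = 1"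
    and small: "norm (\<Sum>g\<in>A. p g *\<^sub>R w g) < e"
    by (rule almost_invariant_l1[OF assms, folded w_def]) (rule that)
  have "\<forall>h\<in>E. \<forall>(T :: 'g \<Rightarrow> 'b) K. (\<forall>x. norm (T x) \<le> K) \<longrightarrow>
      norm (\<Sum>g\<in>A. p g *\<^sub>R (T (h + g) - T g)) \<le> K * e"
  proof (intro ballI allI impI)
    fix h :: 'g and T :: "'g \<Rightarrow> 'b" and K
    assume h: "h \<in> E" and T: "\<forall>x. norm (T x) \<le> K"
    have K: "0 \<le> K" using order_trans[OF norm_ge_zero T[rule_format]] .
    \<comment> \<open>Extending by zero off the fibre over \<open>h\<close> selects the summand for \<open>h\<close> in \<open>w\<close>.\<close>
    define T' where "T' = (\<lambda>(h', x). if h' = h then T x else 0)"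
    have "norm (T' s) \<le> K" for s
      using T K by (simp add: T'_def split: prod.split)
    then obtain L :: "('g \<times> 'g) l1 \<Rightarrow> 'b" where L: "bounded_linear L" "\<And>s. L (point_mass s) = T' s"
      "\<And>a. norm (L a) \<le> K * norm a"
      using l1_extension[of T' K] by metis
    interpret L: bounded_linear L by fact
    have "L (w g) = T (h + g) - T g" for g
    proof -
      have "L (w g) = (\<Sum>h'\<in>E. if h' = h then T (h + g) - T g else 0)"
        unfolding w_def L.sum by (intro sum.cong) (auto simp: L.diff L(2) T'_def)
      with h \<open>finite E\<close> show ?thesis by simp
    qed
    then have "(\<Sum>g\<in>A. p g *\<^sub>R (T (h + g) - T g)) = L (\<Sum>g\<in>A. p g *\<^sub>R w g)"
      by (simp add: L.sum L.scaleR)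
    also have "norm \<dots> \<le> K * e"
      using L(3) mult_left_mono[OF less_imp_le[OF small] K] order_trans by blast
    finally show "norm (\<Sum>g\<in>A. p g *\<^sub>R (T (h + g) - T g)) \<le> K * e" .
  qed
  from that[OF A this] show ?thesis .
qed

section \<open>Approximate diagonals of semigroup algebras\<close>

text \<open>
  Finite sets of algebra elements together with tolerances form a directed set, so it is enough to
  meet each such demand separately.
\<close>

lemma pseudo_amenable_if_finite:
  assumes ex: "\<And>(Y :: 'a::complex_banach_algebra set) e. finite Y \<Longrightarrow> 0 < e \<Longrightarrow>
    \<exists>u. \<forall>a\<in>Y. norm (left_action a u - right_action u a) < e \<and> norm (diagonal_map u * a - a) < e"
  shows "pseudo_amenable TYPE('a)"
proof -
  obtain n :: "'a set \<Rightarrow> real \<Rightarrow> ('a, 'a) ptensor" where n: "\<And>Y e a. finite Y \<Longrightarrow> 0 < e \<Longrightarrow> a \<in> Y \<Longrightarrow>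
      norm (left_action a (n Y e) - right_action (n Y e) a) < e \<and> norm (diagonal_map (n Y e) * a - a) < e"
    using ex by metis
  define D :: "('a set \<times> real) set" where "D = {Y. finite Y} \<times> {0<..}"
  define le :: "'a set \<times> real \<Rightarrow> 'a set \<times> real \<Rightarrow> bool"
    where "le x y \<longleftrightarrow> fst x \<subseteq> fst y \<and> snd y \<le> snd x" for x y
  have "net_approximate_diagonal D le (\<lambda>(Y, e). n Y e)"
    unfolding net_approximate_diagonal_def
  proof (intro conjI ballI allI impI)
    have "({}, 1) \<in> D" by (simp add: D_def)
    then show "D \<noteq> {}" by blast
    show "le i i" for i by (simp add: le_def)
    show "le i k" if "le i j" "le j k" for i j k using that by (auto simp: le_def)
    show "\<exists>k\<in>D. le i k \<and> le j k" if "i \<in> D" "j \<in> D" for i j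
      using that by (intro bexI[of _ "(fst i \<union> fst j, min (snd i) (snd j))"]) (auto simp: D_def le_def)
    fix a :: 'a and e :: real assume e: "0 < e"
    have "norm (left_action a (n Y d) - right_action (n Y d) a) < e \<and> norm (diagonal_map (n Y d) * a - a) < e"
      if "(Y, d) \<in> D" "le ({a}, e) (Y, d)" for Y d
      using n[of Y d a] that by (auto simp: D_def le_def)
    then show "\<exists>i\<in>D. \<forall>j\<in>D. le i j \<longrightarrow>
        norm (left_action a (case j of (Y, e) \<Rightarrow> n Y e) - right_action (case j of (Y, e) \<Rightarrow> n Y e) a) < e \<and>
        norm (diagonal_map (case j of (Y, e) \<Rightarrow> n Y e) * a - a) < e"
      using e by (intro bexI[of _ "({a}, e)"]) (auto simp: D_def)
  qed
  then show ?thesis by (rule pseudo_amenable_if_net)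
qed

lemma bounded_clinear_left_action: "bounded_clinear (left_action a)"
  unfolding left_action_def by (rule bounded_clinear_ptensor_lift[OF bounded_cbilinear_left_action])

lemma bounded_clinear_right_action: "bounded_clinear (\<lambda>u. right_action u a)"
  unfolding right_action_def by (rule bounded_clinear_ptensor_lift[OF bounded_cbilinear_right_action])

lemma bounded_clinear_diagonal_map: "bounded_clinear diagonal_map"
  unfolding diagonal_map_def by (rule bounded_clinear_ptensor_lift[OF bounded_cbilinear_mult])

lemma bounded_clinear_scaleC_map:
  assumes "bounded_clinear h"
  shows "bounded_clinear (\<lambda>x. c *\<^sub>C h x)"
proof -
  interpret h: bounded_linear h using assms by (simp add: bounded_clinear_def)
  have comm: "c *\<^sub>C d *\<^sub>C z = d *\<^sub>C c *\<^sub>C z" for d and z :: 'b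
    by (simp add: scaleC_scaleC mult.commute)
  have "bounded_linear (\<lambda>x. c *\<^sub>C h x)"
  proof (rule bounded_linear_compose[of "\<lambda>z. c *\<^sub>C z", OF bounded_linear_intro[where K = "cmod c"]])
    show "c *\<^sub>C (r *\<^sub>R z) = r *\<^sub>R (c *\<^sub>C z)" for r and z :: 'b
      using comm[of "complex_of_real r" z] by (simp add: scaleC_of_real)
  qed (simp_all add: scaleC_add_right norm_scaleC h.bounded_linear_axioms mult.commute)
  then show ?thesis
    using assms comm by (simp add: bounded_clinear_def)
qed

lemma bounded_clinear_imp_bounded_linear: "bounded_clinear f \<Longrightarrow> bounded_linear f"
  by (simp add: bounded_clinear_def)

lemma
  assumes f: "bounded_clinear f" and g: "bounded_clinear g"
  shows bounded_clinear_add_maps: "bounded_clinear (\<lambda>x. f x + g x)"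
    and bounded_clinear_diff_maps: "bounded_clinear (\<lambda>x. f x - g x)"
proof -
  show "bounded_clinear (\<lambda>x. f x + g x)"
    using f g by (simp add: bounded_clinear_def bounded_linear_add scaleC_add_right)
  have "c *\<^sub>C (x - y) = c *\<^sub>C x - c *\<^sub>C y" for c and x y :: 'b
    using scaleC_add_right[of c "x - y" y] by (simp add: eq_diff_eq)
  then show "bounded_clinear (\<lambda>x. f x - g x)"
    using f g by (simp add: bounded_clinear_def bounded_linear_sub)
qed

lemma bounded_clinearI:
  fixes f :: "'a::complex_normed_vector \<Rightarrow> 'b::complex_normed_vector"
  assumes "\<And>x y. f (x + y) = f x + f y" "\<And>c x. f (c *\<^sub>C x) = c *\<^sub>C f x" "\<And>x. norm (f x) \<le> norm x * K"
  shows "bounded_clinear f"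
proof -
  have "f (r *\<^sub>R x) = r *\<^sub>R f x" for r x
    using assms(2)[of "complex_of_real r"] by (simp add: scaleC_of_real)
  then show ?thesis
    using assms bounded_linear_intro[of f K] by (simp add: bounded_clinear_def)
qed

interpretation tensor: bounded_bilinear "(\<otimes>) :: 'a::complex_banach \<Rightarrow> 'b::complex_banach \<Rightarrow> _"
  by (rule bounded_cbilinear_tensor[unfolded bounded_cbilinear_def, THEN conjunct1])

lemma tensor_scaleC: "(c *\<^sub>C a) \<otimes> b = c *\<^sub>C (a \<otimes> b)" "a \<otimes> (c *\<^sub>C b) = c *\<^sub>C (a \<otimes> b)"
  using bounded_cbilinear_tensor by (auto simp: bounded_cbilinear_def)

lemma bounded_clinear_left_action_arg: "bounded_clinear (\<lambda>a. left_action a u)"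
proof (rule bounded_clinearI)
  fix a b :: 'a and c
  have "left_action (a + b) = (\<lambda>u. left_action a u + left_action b u)"
    unfolding left_action_def[of "a + b"]
    by (rule ptensor_lift_eqI)
      (simp_all add: bounded_clinear_add_maps bounded_clinear_left_action left_action_tensor
        distrib_right tensor.add_left)
  then show "left_action (a + b) u = left_action a u + left_action b u" by simp
  have "left_action (c *\<^sub>C a) = (\<lambda>u. c *\<^sub>C left_action a u)"
    unfolding left_action_def[of "c *\<^sub>C a"]
    by (rule ptensor_lift_eqI)
      (simp_all add: bounded_clinear_scaleC_map bounded_clinear_left_action left_action_tensor
        mult_scaleC_left tensor_scaleC)
  then show "left_action (c *\<^sub>C a) u = c *\<^sub>C left_action a u" by simp
  have "norm ((a * x) \<otimes> y) \<le> norm a * (norm x * norm y)" for x y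
    using order_trans[OF norm_tensor_le mult_right_mono[OF norm_mult_ineq norm_ge_zero], of a x y]
    by (simp add: mult.assoc)
  then show "norm (left_action a u) \<le> norm a * norm u"
    unfolding left_action_def by (intro norm_ptensor_lift_le bounded_cbilinear_left_action) auto
qed

lemma bounded_clinear_right_action_arg: "bounded_clinear (\<lambda>a. right_action u a)"
proof (rule bounded_clinearI)
  fix a b :: 'a and c
  have "(\<lambda>u. right_action u (a + b)) = (\<lambda>u. right_action u a + right_action u b)"
    unfolding right_action_def[of _ "a + b"]
    by (rule ptensor_lift_eqI)
      (simp_all add: bounded_clinear_add_maps bounded_clinear_right_action right_action_tensor
        distrib_left tensor.add_right)
  then show "right_action u (a + b) = right_action u a + right_action u b" by metis
  have "(\<lambda>u. right_action u (c *\<^sub>C a)) = (\<lambda>u. c *\<^sub>C right_action u a)"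
    unfolding right_action_def[of _ "c *\<^sub>C a"]
    by (rule ptensor_lift_eqI)
      (simp_all add: bounded_clinear_scaleC_map bounded_clinear_right_action right_action_tensor
        mult_scaleC_right tensor_scaleC)
  then show "right_action u (c *\<^sub>C a) = c *\<^sub>C right_action u a" by metis
  have "norm (x \<otimes> (y * a)) \<le> norm a * (norm x * norm y)" for x y
    using order_trans[OF norm_tensor_le mult_left_mono[OF norm_mult_ineq norm_ge_zero], of x y a]
    by (simp add: mult_ac)
  then show "norm (right_action u a) \<le> norm a * norm u"
    unfolding right_action_def by (intro norm_ptensor_lift_le bounded_cbilinear_right_action) auto
qed

text \<open>
  An approximate diagonal may be unbounded, so convergence on the point masses does not pass to
  their closed linear span by density alone. It does if the commutators and the errors of the
  approximate unit are bounded on all point masses by a constant that does not depend on \<open>u\<close>.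
\<close>

lemma pseudo_amenable_l1I:
  fixes K :: real
  assumes ex: "\<And>(X :: 's::semigroup_mult set) e. finite X \<Longrightarrow> 0 < e \<Longrightarrow> \<exists>u.
    (\<forall>s. norm (left_action (point_mass s) u - right_action u (point_mass s)) \<le> K \<and>
      norm (diagonal_map u * point_mass s - point_mass s) \<le> K) \<and>
    (\<forall>s\<in>X. norm (left_action (point_mass s) u - right_action u (point_mass s)) \<le> e \<and>
      norm (diagonal_map u * point_mass s - point_mass s) \<le> e)"
  shows "pseudo_amenable TYPE('s l1)"
proof (rule pseudo_amenable_if_finite)
  fix Y :: "'s l1 set" and e :: real assume Y: "finite Y" and e: "0 < e"
  have K: "0 \<le> K"
    using ex[of "{}" 1] norm_ge_zero order_trans by (metis finite.emptyI zero_less_one)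
  define N where "N = 1 + sum norm Y"
  have N: "norm a < N" if "a \<in> Y" for a
    using member_le_sum[OF that, of norm] Y by (simp add: N_def)
  have N0: "0 < N" unfolding N_def by (simp add: add_pos_nonneg sum_nonneg)
  \<comment> \<open>The error \<open>e\<close> is split evenly: \<open>K * d\<close> bounds the part off \<open>X\<close> and \<open>c * N\<close> the part on \<open>X\<close>,
    where \<open>N\<close> exceeds the norms of the elements of \<open>Y\<close>.\<close>
  define d where "d = e / (2 * (K + 1))"
  have d: "0 < d" "K * d \<le> e / 2"
    using e K by (auto simp: d_def field_simps add_pos_nonneg)
  have "\<exists>X. finite X \<and> (\<Sum>\<^sub>\<infinity>s\<in>- X. cmod (l1_fun a s)) < d" for a :: "'s l1"
  proof -
    have "((\<lambda>s. cmod (l1_fun a s)) has_sum norm a) UNIV"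
      unfolding norm_l1_def by (rule has_sum_infsum[OF l1_fun_abs_summable])
    from this[unfolded has_sum_def, THEN tendstoD, OF d(1)]
    obtain X where X: "finite X" "dist (\<Sum>s\<in>X. cmod (l1_fun a s)) (norm a) < d"
      by (auto simp: eventually_finite_subsets_at_top)
    have "(\<Sum>\<^sub>\<infinity>s\<in>UNIV - X. cmod (l1_fun a s)) = norm a - (\<Sum>s\<in>X. cmod (l1_fun a s))"
      using X by (subst infsum_Diff) (auto simp: l1_fun_abs_summable norm_l1_def)
    with X show ?thesis
      by (intro exI[of _ X]) (auto simp: dist_norm Compl_eq_Diff_UNIV)
  qed
  then obtain Z :: "'s l1 \<Rightarrow> 's set" where Z: "\<And>a. finite (Z a)" "\<And>a. (\<Sum>\<^sub>\<infinity>s\<in>- Z a. cmod (l1_fun a s)) < d"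
    by metis
  define X where "X = \<Union> (Z ` Y)"
  have X: "finite X" using Y Z(1) by (simp add: X_def)
  have tail: "(\<Sum>\<^sub>\<infinity>s\<in>- X. cmod (l1_fun a s)) < d" if "a \<in> Y" for a
  proof -
    have "(\<Sum>\<^sub>\<infinity>s\<in>- X. cmod (l1_fun a s)) \<le> (\<Sum>\<^sub>\<infinity>s\<in>- Z a. cmod (l1_fun a s))"
      by (rule infsum_mono_neutral) (use that in \<open>auto simp: X_def intro: summable_on_subset[OF l1_fun_abs_summable]\<close>)
    with Z(2)[of a] show ?thesis by simp
  qed
  define c where "c = e / (2 * N)"
  have c: "0 < c" using e N0 by (simp add: c_def)
  obtain u where u: "\<And>s. norm (left_action (point_mass s) u - right_action u (point_mass s)) \<le> K"
      "\<And>s. norm (diagonal_map u * point_mass s - point_mass s) \<le> K"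
      "\<And>s. s \<in> X \<Longrightarrow> norm (left_action (point_mass s) u - right_action u (point_mass s)) \<le> c"
      "\<And>s. s \<in> X \<Longrightarrow> norm (diagonal_map u * point_mass s - point_mass s) \<le> c"
    using ex[OF X c] by blast
  have lt: "norm (L a) < e"
    if "bounded_clinear L" "\<And>s. s \<in> X \<Longrightarrow> norm (L (point_mass s)) \<le> c" "\<And>s. norm (L (point_mass s)) \<le> K"
      "a \<in> Y" for a and L :: "'s l1 \<Rightarrow> 'c::complex_banach"
  proof -
    have "norm (L a) \<le> c * norm a + K * (\<Sum>\<^sub>\<infinity>s\<in>- X. cmod (l1_fun a s))"
      by (rule l1_operator_bound[OF that(1) less_imp_le[OF c] that(2,3)])
    also have "c * norm a < c * N"
      using c N[OF that(4)] by simp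
    also have "c * N = e / 2"
      using N0 by (simp add: c_def)
    also have "K * (\<Sum>\<^sub>\<infinity>s\<in>- X. cmod (l1_fun a s)) \<le> K * d"
      by (rule mult_left_mono[OF less_imp_le[OF tail[OF that(4)]] K])
    also have "K * d \<le> e / 2" by (rule d(2))
    finally show ?thesis by simp
  qed
  have "bounded_clinear (\<lambda>a. left_action a u - right_action u a)"
    by (rule bounded_clinear_diff_maps[OF bounded_clinear_left_action_arg bounded_clinear_right_action_arg])
  then have "norm (left_action a u - right_action u a) < e" if "a \<in> Y" for a
    by (rule lt[of "\<lambda>a. left_action a u - right_action u a", OF _ u(3,1) that])
  moreover have "bounded_clinear (\<lambda>a. diagonal_map u * a)" "bounded_clinear (\<lambda>a :: 's l1. a)"
    by (simp_all add: bounded_clinear_def bounded_linear_mult_right mult_scaleC_right)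
  then have "norm (diagonal_map u * a - a) < e" if "a \<in> Y" for a
    by (intro lt[of "\<lambda>a. diagonal_map u * a - a", OF bounded_clinear_diff_maps u(4,2) that])
  ultimately show "\<exists>u. \<forall>a\<in>Y. norm (left_action a u - right_action u a) < e \<and> norm (diagonal_map u * a - a) < e"
    by blast
qed

section \<open>The Brandt semigroup algebra\<close>

text \<open>
  Subtracting the mass at the null element makes products with mismatched indices vanish instead of
  yielding $\delta_o$.
\<close>

definition matrix_unit :: "'i \<Rightarrow> 'g \<Rightarrow> 'i \<Rightarrow> ('i, 'g) brandt l1"
  where "matrix_unit i g j = point_mass (Elem i g j) - point_mass Null"

lemma Null_mult: "Null * s = (Null :: ('i, 'g::group_add) brandt)" "s * Null = (Null :: ('i, 'g) brandt)"
  by (cases s; simp)+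

lemma matrix_unit_mult:
  "point_mass (Elem k h l) * matrix_unit i g j = (if l = i then matrix_unit k (h + g) j else 0)"
  "matrix_unit i g j * point_mass (Elem k h l) = (if j = k then matrix_unit i (g + h) l else 0)"
  "point_mass Null * matrix_unit i g j = 0"
  "matrix_unit i g j * point_mass Null = 0"
  "matrix_unit i g j * matrix_unit k h l = (if j = k then matrix_unit i (g + h) l else 0)"
  by (simp_all add: matrix_unit_def left_diff_distrib right_diff_distrib point_mass_mult Null_mult)

lemma norm_matrix_unit: "norm (matrix_unit i g j) \<le> 2"
  unfolding matrix_unit_def by (rule order_trans[OF norm_triangle_ineq4]) (simp add: norm_point_mass)

lemma norm_matrix_unit_tensor: "norm (matrix_unit i g j \<otimes> matrix_unit k h l) \<le> 4"
  using order_trans[OF norm_tensor_le mult_mono[OF norm_matrix_unit norm_matrix_unit]] by simp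

text \<open>
  All tensors pass through the single index \<open>k\<close>, as in the diagonal
  $\sum_i E_{ik} \otimes E_{ki}$ of a matrix algebra. No averaging over \<open>F\<close> is involved, so
  left and right multiplication by a point mass leave at most one index of \<open>F\<close> each.
\<close>

definition brandt_diagonal ::
    "'i \<Rightarrow> 'i set \<Rightarrow> 'g set \<Rightarrow> ('g \<Rightarrow> real) \<Rightarrow> (('i, 'g::group_add) brandt l1, ('i, 'g) brandt l1) ptensor"
  where "brandt_diagonal k F A p =
    (\<Sum>i\<in>F. \<Sum>g\<in>A. p g *\<^sub>R (matrix_unit i g k \<otimes> matrix_unit k (- g) i)) + point_mass Null \<otimes> point_mass Null"

lemma norm_convex_combination_le:
  fixes T :: "'x \<Rightarrow> 'b::real_normed_vector" and p :: "'x \<Rightarrow> real"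
  assumes "\<forall>x\<in>A. 0 \<le> p x" "sum p A = 1" and "\<And>x. norm (T x) \<le> K"
  shows "norm (\<Sum>x\<in>A. p x *\<^sub>R T x) \<le> K"
proof -
  have "norm (\<Sum>x\<in>A. p x *\<^sub>R T x) \<le> (\<Sum>x\<in>A. p x * K)"
    using assms(1,3) by (intro sum_norm_le) (simp add: mult_left_mono)
  then show ?thesis using assms(2) by (simp flip: sum_distrib_right)
qed

context
  fixes k :: 'i and F :: "'i set" and A :: "'g::group_add set" and p :: "'g \<Rightarrow> real"
  assumes F: "finite F" and p0: "\<forall>g\<in>A. 0 \<le> p g" and p1: "sum p A = 1"
begin

lemma left_action_brandt_diagonal:
  "left_action (point_mass (Elem i h j)) (brandt_diagonal k F A p) =
    (if j \<in> F then \<Sum>g\<in>A. p g *\<^sub>R (matrix_unit i (h + g) k \<otimes> matrix_unit k (- g) j) else 0) +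
    point_mass Null \<otimes> point_mass Null"
proof -
  interpret L: bounded_linear "left_action (point_mass (Elem i h j))"
    by (rule bounded_clinear_imp_bounded_linear[OF bounded_clinear_left_action])
  have "left_action (point_mass (Elem i h j)) (brandt_diagonal k F A p) =
    (\<Sum>i'\<in>F. if i' = j then \<Sum>g\<in>A. p g *\<^sub>R (matrix_unit i (h + g) k \<otimes> matrix_unit k (- g) j) else 0) +
    point_mass Null \<otimes> point_mass Null"
    unfolding brandt_diagonal_def L.add L.sum L.scaleR left_action_tensor
    by (intro arg_cong2[where f = "(+)"] sum.cong)
      (auto simp: matrix_unit_mult point_mass_mult Null_mult tensor.zero_left)
  then show ?thesis using F by simp
qed

lemma right_action_brandt_diagonal:
  "right_action (brandt_diagonal k F A p) (point_mass (Elem i h j)) =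
    (if i \<in> F then \<Sum>g\<in>A. p g *\<^sub>R (matrix_unit i g k \<otimes> matrix_unit k (- g + h) j) else 0) +
    point_mass Null \<otimes> point_mass Null"
proof -
  interpret R: bounded_linear "\<lambda>u. right_action u (point_mass (Elem i h j))"
    by (rule bounded_clinear_imp_bounded_linear[OF bounded_clinear_right_action])
  have "right_action (brandt_diagonal k F A p) (point_mass (Elem i h j)) =
    (\<Sum>i'\<in>F. if i' = i then \<Sum>g\<in>A. p g *\<^sub>R (matrix_unit i g k \<otimes> matrix_unit k (- g + h) j) else 0) +
    point_mass Null \<otimes> point_mass Null"
    unfolding brandt_diagonal_def R.add R.sum R.scaleR right_action_tensor
    by (intro arg_cong2[where f = "(+)"] sum.cong)
      (auto simp: matrix_unit_mult point_mass_mult Null_mult tensor.zero_right)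
  then show ?thesis using F by simp
qed

lemma commutator_Null_brandt_diagonal:
  "left_action (point_mass Null) (brandt_diagonal k F A p) =
    right_action (brandt_diagonal k F A p) (point_mass Null)"
proof -
  interpret L: bounded_linear "left_action (point_mass (Null :: ('i, 'g) brandt))"
    by (rule bounded_clinear_imp_bounded_linear[OF bounded_clinear_left_action])
  interpret R: bounded_linear "\<lambda>u. right_action u (point_mass (Null :: ('i, 'g) brandt))"
    by (rule bounded_clinear_imp_bounded_linear[OF bounded_clinear_right_action])
  show ?thesis
    unfolding brandt_diagonal_def L.add L.sum L.scaleR R.add R.sum R.scaleR
      left_action_tensor right_action_tensor
    by (simp add: matrix_unit_mult point_mass_mult tensor.zero_left tensor.zero_right)
qed

text \<open>
  Each of the two actions leaves a convex combination of tensors of norm at most 4, whatever the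
  size of \<open>F\<close>; the terms $\delta_o \otimes \delta_o$ cancel.
\<close>

lemma norm_commutator_brandt_diagonal:
  "norm (left_action (point_mass s) (brandt_diagonal k F A p) -
    right_action (brandt_diagonal k F A p) (point_mass s)) \<le> 8"
proof (cases s)
  case Null
  then show ?thesis by (simp add: commutator_Null_brandt_diagonal)
next
  case (Elem i h j)
  let ?l = "if j \<in> F then \<Sum>g\<in>A. p g *\<^sub>R (matrix_unit i (h + g) k \<otimes> matrix_unit k (- g) j) else 0"
  let ?r = "if i \<in> F then \<Sum>g\<in>A. p g *\<^sub>R (matrix_unit i g k \<otimes> matrix_unit k (- g + h) j) else 0"
  have "norm ?l \<le> 4" "norm ?r \<le> 4"
    by (simp_all add: norm_convex_combination_le[OF p0 p1] norm_matrix_unit_tensor)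
  then have "norm (?l - ?r) \<le> 8"
    using norm_triangle_ineq4[of ?l ?r] by linarith
  then show ?thesis
    by (simp only: Elem left_action_brandt_diagonal right_action_brandt_diagonal add_diff_cancel_right)
qed

text \<open>
  With $x = hg$ the left action produces $e_{ik}(hg) \otimes e_{kj}(g^{-1}) = T(hg)$, since
  $x^{-1}h = g^{-1}$; the right action produces $T(g)$.
\<close>

lemma commutator_brandt_diagonal:
  fixes h :: 'g
  assumes "i \<in> F" "j \<in> F"
  defines "T \<equiv> \<lambda>x. matrix_unit i x k \<otimes> matrix_unit k (- x + h) j"
  shows "left_action (point_mass (Elem i h j)) (brandt_diagonal k F A p) -
    right_action (brandt_diagonal k F A p) (point_mass (Elem i h j)) = (\<Sum>g\<in>A. p g *\<^sub>R (T (h + g) - T g))"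
proof -
  have "T (h + g) = matrix_unit i (h + g) k \<otimes> matrix_unit k (- g) j" for g
    by (simp add: T_def minus_add add.assoc)
  then show ?thesis
    using assms(1,2)
    by (simp add: left_action_brandt_diagonal right_action_brandt_diagonal scaleR_diff_right sum_subtractf)
      (simp add: T_def)
qed

lemma diagonal_map_brandt_diagonal:
  "diagonal_map (brandt_diagonal k F A p) * point_mass s =
    (case s of Null \<Rightarrow> point_mass s | Elem i h j \<Rightarrow> if i \<in> F then point_mass s else point_mass Null)"
proof -
  interpret M: bounded_linear "diagonal_map :: (('i, 'g) brandt l1, _) ptensor \<Rightarrow> _"
    by (rule bounded_clinear_imp_bounded_linear[OF bounded_clinear_diagonal_map])
  have one: "(\<Sum>g\<in>A. p g *\<^sub>R x) = x" for x :: "('i, 'g) brandt l1"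
    using p1 by (simp flip: scaleR_sum_left)
  have *: "diagonal_map (brandt_diagonal k F A p) = (\<Sum>i\<in>F. matrix_unit i 0 i) + point_mass Null"
    unfolding brandt_diagonal_def M.add M.sum M.scaleR diagonal_map_tensor
    by (simp add: matrix_unit_mult point_mass_mult one)
  show ?thesis
  proof (cases s)
    case Null
    then show ?thesis
      by (simp add: * distrib_right sum_distrib_right matrix_unit_mult point_mass_mult)
  next
    case (Elem i h j)
    then have "diagonal_map (brandt_diagonal k F A p) * point_mass s =
      (\<Sum>i'\<in>F. if i' = i then matrix_unit i h j else 0) + point_mass Null"
      unfolding * distrib_right sum_distrib_right
      by (intro arg_cong2[where f = "(+)"] sum.cong) (auto simp: matrix_unit_mult point_mass_mult)
    then show ?thesis using Elem F by (simp add: matrix_unit_def)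
  qed
qed

end

theorem theorem3:
  assumes "amenable_group TYPE('g::group_add)"
  shows "pseudo_amenable TYPE(('i, 'g) brandt l1)"
proof (rule pseudo_amenable_l1I[where K = 8])
  fix X :: "('i, 'g) brandt set" and e :: real
  assume X: "finite X" and e: "0 < e"
  define E where "E = (\<Union>s\<in>X. case s of Null \<Rightarrow> {} | Elem i h j \<Rightarrow> {h})"
  define F where "F = (\<Union>s\<in>X. case s of Null \<Rightarrow> {} | Elem i h j \<Rightarrow> {i, j})"
  have E: "finite E" and F: "finite F"
    using X by (auto simp: E_def F_def split: brandt.split)
  have mem: "i \<in> F" "j \<in> F" "h \<in> E" if "Elem i h j \<in> X" for i h j
    using that by (auto simp: E_def F_def intro!: bexI[OF _ that])
  \<comment> \<open>The tensors to which almost invariance is applied have norm at most 4.\<close>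
  have "0 < e / 4" using e by simp
  obtain A :: "'g set" and p where A: "\<forall>g\<in>A. 0 \<le> p g" "sum p A = 1"
    and inv: "\<forall>h\<in>E. \<forall>(T :: 'g \<Rightarrow> (('i, 'g) brandt l1, ('i, 'g) brandt l1) ptensor) K.
      (\<forall>x. norm (T x) \<le> K) \<longrightarrow> norm (\<Sum>g\<in>A. p g *\<^sub>R (T (h + g) - T g)) \<le> K * (e / 4)"
    by (rule almost_invariant_combination[OF assms E \<open>0 < e / 4\<close>, where ?'b = "(('i, 'g) brandt l1, ('i, 'g) brandt l1) ptensor"])
      (rule that)
  \<comment> \<open>Any index will do; the index type is nonempty.\<close>
  obtain k :: 'i where True by blast
  note D = F A
  let ?u = "brandt_diagonal k F A p"
  have "norm (left_action (point_mass s) ?u - right_action ?u (point_mass s)) \<le> 8" for s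
    by (rule norm_commutator_brandt_diagonal[OF D])
  moreover have "norm (diagonal_map ?u * point_mass s - point_mass s) \<le> 8" for s
  proof -
    have "norm (diagonal_map ?u * point_mass s) = 1"
      by (simp add: diagonal_map_brandt_diagonal[OF D] norm_point_mass split: brandt.split)
    then show ?thesis
      using norm_triangle_ineq4[of "diagonal_map ?u * point_mass s" "point_mass s"] by (simp add: norm_point_mass)
  qed
  moreover have "norm (left_action (point_mass s) ?u - right_action ?u (point_mass s)) \<le> e" if "s \<in> X" for s
  proof (cases s)
    case Null
    with e show ?thesis by (simp add: commutator_Null_brandt_diagonal[OF D])
  next
    case (Elem i h j)
    with that have "Elem i h j \<in> X" by simp
    note m = mem[OF this]
    let ?T = "\<lambda>x. matrix_unit i x k \<otimes> matrix_unit k (- x + h) j"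
    have "norm (\<Sum>g\<in>A. p g *\<^sub>R (?T (h + g) - ?T g)) \<le> 4 * (e / 4)"
      by (rule inv[rule_format, OF m(3), of ?T 4, OF norm_matrix_unit_tensor])
    then show ?thesis
      unfolding Elem commutator_brandt_diagonal[OF D m(1,2)] by simp
  qed
  moreover have "norm (diagonal_map ?u * point_mass s - point_mass s) \<le> e" if "s \<in> X" for s
  proof (cases s)
    case Null
    with e show ?thesis by (simp add: diagonal_map_brandt_diagonal[OF D])
  next
    case (Elem i h j)
    with that have "i \<in> F" using mem(1) by blast
    with e show ?thesis by (simp add: Elem diagonal_map_brandt_diagonal[OF D])
  qed
  ultimately show "\<exists>u.
    (\<forall>s. norm (left_action (point_mass s) u - right_action u (point_mass s)) \<le> 8 \<and>
      norm (diagonal_map u * point_mass s - point_mass s) \<le> 8) \<and>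
    (\<forall>s\<in>X. norm (left_action (point_mass s) u - right_action u (point_mass s)) \<le> e \<and>
      norm (diagonal_map u * point_mass s - point_mass s) \<le> e)"
    by (intro exI[of _ ?u] conjI allI ballI)
qed

end
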